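(* For every $v\in K$ and every $\nu=y\otimes\mathrm{d}x+\nu^s\in K^*$, where $y\in(L^1(\Omega))^d$ and $\nu^s\in(\mathrm{ba}(\Omega))^d$ is the singular part of $\nu$, the primal-dual gap estimator $\eta_{\mathrm{gap}}^2(v,\nu):=I(v)-D(\nu)$ satisfies $$\eta_{\mathrm{gap}}^2(v,\nu)=\eta_{\mathrm{gap},A}^2(v,y)+\eta_{\mathrm{gap},B}^2(v,\nu^s),$$ where $$\eta_{\mathrm{gap},A}^2(v,y):=\int_\Omega\{\phi(\cdot,\nabla v)-\nabla v\cdot y+\phi^*(\cdot,y)\}\,\mathrm{d}x,$$ $$\eta_{\mathrm{gap},B}^2(v,\nu^s):=|\zeta\nu^s|(\Omega)-\langle\nu^s,\nabla v\rangle_{(L^\infty(\Omega))^d}.$$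
   Context: Let $\Omega\subseteq\mathbb{R}^d$, $d\in\mathbb{N}$, be a bounded simplicial Lipschitz domain (polyhedral, i.e. exactly decomposable into simplices) whose boundary is divided into two disjoint relatively open parts $\Gamma_D$ with $|\Gamma_D|>0$ (surface measure) and $\Gamma_N$, $\partial\Omega=\overline\Gamma_D\cup\overline\Gamma_N$. Write $(v,w)_\omega=\int_\omega v\cdot w$, $\|\cdot\|_{p,\omega}$ for the $L^p(\omega)$-norm (Euclidean norm for vectors). Traces are not denoted explicitly. $W^{1,\infty}_D(\Omega)=\{v\in W^{1,\infty}(\Omega): v=0\text{ a.e. on }\Gamma_D\}$. $W^{-1,1}(\Gamma_N)$ denotes the dual of $W^{1,\infty}(\Gamma_N)$ and $\langle\cdot,\cdot\rangle_{\Gamma_N}$ the duality pairing. Data: $f\in L^1(\Omega)$, $g\in W^{-1,1}(\Gamma_N)$, $\zeta\in L^\infty(\Omega)$ with $\operatorname{ess\,inf}_\Omega\zeta>0$, $u_D\in W^{1,\infty}(\Gamma_D)$ such that there is a (fixed) $\widehat u_D\in W^{1,\infty}(\Omega)$ with $\widehat u_D=u_D$ on $\Gamma_D$ and $\|\nabla\widehat u_D/\zeta\|_{\infty,\Omega}<1$. For a.e. $x\in\Omega$ and $t,s\in\mathbb{R}^d$: $\phi(x,t)=\frac12|t|^2$ if $|t|\le\zeta(x)$ and $+\infty$ otherwise; its Fenchel conjugate in the second argument is $\phi^*(x,s)=\frac12|s|^2$ if $|s|\le\zeta(x)$ and $\phi^*(x,s)=\zeta(x)|s|-\frac12\zeta(x)^2$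 if $|s|>\zeta(x)$. Primal functional: $K=\{v\in W^{1,\infty}(\Omega): |\nabla v|\le\zeta\text{ a.e. in }\Omega,\ v=u_D\text{ a.e. on }\Gamma_D\}$, and $I:W^{1,\infty}(\Omega)\to\mathbb{R}\cup\{+\infty\}$, $I(v)=\frac12\|\nabla v\|_{2,\Omega}^2-(f,v)_\Omega-\langle g,v\rangle_{\Gamma_N}$ if $v\in K$, $I(v)=+\infty$ otherwise. Finitely additive measures: $(\mathrm{ba}(\Omega))^d$ is the space of finitely additive $\mathbb{R}^d$-valued set functions $\nu$ on the Lebesgue measurable subsets of $\Omega$ that vanish on Lebesgue null sets and have finite total variation $|\nu|(\Omega)=\sup\sum_i|\nu(A_i)|$ (supremum over countable measurable partitions $(A_i)$ of $\Omega$). It is isometrically isomorphic to $((L^\infty(\Omega))^d)^*$ via $\langle\nu,y\rangle_{(L^\infty(\Omega))^d}=\int_\Omega y\cdot\mathrm{d}\nu$. For $y\in(L^1(\Omega))^d$, $y\otimes\mathrm{d}x$ is the element $\widehat y\mapsto\int_\Omega y\cdot\widehat y\,\mathrm{d}x$. Every $\nu\in(\mathrm{ba}(\Omega))^d$ decomposes uniquely as $\nu=y\otimes\mathrm{d}x+\nu^s$ with $y\in(L^1(\Omega))^d$ and $\nu^s\in(\mathrm{ba}(\Omega))^d$ singular (Lebesgue/Yosida–Hewitt decomposition: there are decreasing measurable sets $E_n$ with $|E_n|\to0$ and $|\nu^s|(\Omega\setminus E_n)=0$ for all $n$). $\zeta\nu^s\in(\mathrm{ba}(\Omega))^d$ is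 $(\zeta\nu^s)(A)=\int_A\zeta\,\mathrm{d}\nu^s$. Dual functional: $K^*=\{\nu\in(\mathrm{ba}(\Omega))^d:\langle\nu,\nabla v\rangle_{(L^\infty(\Omega))^d}=(f,v)_\Omega+\langle g,v\rangle_{\Gamma_N}\ \forall v\in W^{1,\infty}_D(\Omega)\}$, and for $\nu=y\otimes\mathrm{d}x+\nu^s$, $D(\nu)=-\int_\Omega\phi^*(\cdot,y)\,\mathrm{d}x-|\zeta\nu^s|(\Omega)+\langle\nu,\nabla\widehat u_D\rangle_{(L^\infty(\Omega))^d}-(f,\widehat u_D)_\Omega-\langle g,\widehat u_D\rangle_{\Gamma_N}$ if $\nu\in K^*$, and $D(\nu)=-\infty$ otherwise. *)

theory Defs
  imports "HOL-Analysis.Analysis" "HOL-Probability.Essential_Supremum"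
begin

section \<open>Domains and surface measure\<close>

text \<open>Near each boundary point, \<open>\<Omega>\<close> is, in suitable orthogonal coordinates, the part of a ball
  lying strictly on one side of the graph of a Lipschitz function of the coordinates in the
  hyperplane orthogonal to the unit vector \<open>e\<close>.\<close>

definition lipschitz_domain :: "(real ^ 'd) set \<Rightarrow> bool" where
  "lipschitz_domain \<Omega> \<longleftrightarrow> open \<Omega> \<and> connected \<Omega> \<and> \<Omega> \<noteq> {} \<and>
     (\<forall>x\<in>frontier \<Omega>. \<exists>r>0. \<exists>e \<gamma> L. norm e = 1 \<and> L-lipschitz_on {z. z \<bullet> e = 0} \<gamma> \<and>
        \<Omega> \<inter> ball x r = {z \<in> ball x r. \<gamma> (z - (z \<bullet> e) *\<^sub>R e) < z \<bullet> e})"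

definition simplicial_domain :: "(real ^ 'd) set \<Rightarrow> bool" where
  "simplicial_domain \<Omega> \<longleftrightarrow>
     (\<exists>\<T>. triangulation \<T> \<and> (\<forall>T\<in>\<T>. int CARD('d) simplex T) \<and> \<Union>\<T> = closure \<Omega>)"

definition hausdorff_outer :: "nat \<Rightarrow> 'a::metric_space set \<Rightarrow> ennreal" where
  "hausdorff_outer s A =
     (SUP \<delta>\<in>{0<..}. INF E\<in>{E :: nat \<Rightarrow> 'a set.
          A \<subseteq> (\<Union>i. E i) \<and> (\<forall>i. bounded (E i) \<and> diameter (E i) \<le> \<delta>)}.
        (\<Sum>i. if E i = {} then 0 else ennreal (unit_ball_vol (real s) * (diameter (E i) / 2) ^ s)))"

definition surface_measure :: "(real ^ 'd) set \<Rightarrow> ennreal" where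
  "surface_measure A = hausdorff_outer (CARD('d) - 1) A"

definition surface_AE :: "(real ^ 'd) set \<Rightarrow> (real ^ 'd \<Rightarrow> bool) \<Rightarrow> bool" where
  "surface_AE \<Gamma> P \<longleftrightarrow> surface_measure {x\<in>\<Gamma>. \<not> P x} = 0"

definition boundary_partition :: "(real ^ 'd) set \<Rightarrow> (real ^ 'd) set \<Rightarrow> (real ^ 'd) set \<Rightarrow> bool" where
  "boundary_partition \<Omega> \<Gamma>\<^sub>D \<Gamma>\<^sub>N \<longleftrightarrow>
     openin (top_of_set (frontier \<Omega>)) \<Gamma>\<^sub>D \<and> openin (top_of_set (frontier \<Omega>)) \<Gamma>\<^sub>N \<and>
     \<Gamma>\<^sub>D \<inter> \<Gamma>\<^sub>N = {} \<and> frontier \<Omega> = closure \<Gamma>\<^sub>D \<union> closure \<Gamma>\<^sub>N"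


section \<open>Lebesgue and Sobolev spaces\<close>

text \<open>Elements of these spaces are functions, not classes modulo equality almost everywhere.\<close>

definition L1_space :: "(real ^ 'd) set \<Rightarrow> (real ^ 'd \<Rightarrow> 'b::euclidean_space) set" where
  "L1_space \<Omega> = {f. integrable (lebesgue_on \<Omega>) f}"

definition Linf_norm :: "(real ^ 'd) set \<Rightarrow> (real ^ 'd \<Rightarrow> 'b::euclidean_space) \<Rightarrow> ereal" where
  "Linf_norm \<Omega> f = esssup (lebesgue_on \<Omega>) (\<lambda>x. ereal (norm (f x)))"

definition Linf_space :: "(real ^ 'd) set \<Rightarrow> (real ^ 'd \<Rightarrow> 'b::euclidean_space) set" where
  "Linf_space \<Omega> = {f \<in> borel_measurable (lebesgue_on \<Omega>). Linf_norm \<Omega> f < \<infinity>}"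

definition essinf :: "'a measure \<Rightarrow> ('a \<Rightarrow> ereal) \<Rightarrow> ereal" where
  "essinf M f = - esssup M (\<lambda>x. - f x)"

primrec Ck :: "nat \<Rightarrow> (real ^ 'd \<Rightarrow> real) \<Rightarrow> bool" where
  "Ck 0 \<phi> \<longleftrightarrow> continuous_on UNIV \<phi>"
| "Ck (Suc k) \<phi> \<longleftrightarrow>
     (\<exists>\<phi>'. (\<forall>x. GDERIV \<phi> x :> \<phi>' x) \<and> (\<forall>i. Ck k (\<lambda>x. \<phi>' x $ i)))"

definition test_functions :: "(real ^ 'd) set \<Rightarrow> (real ^ 'd \<Rightarrow> real) set" where
  "test_functions \<Omega> = {\<phi>. (\<forall>k. Ck k \<phi>) \<and> compact (closure {x. \<phi> x \<noteq> 0}) \<and>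
                          closure {x. \<phi> x \<noteq> 0} \<subseteq> \<Omega>}"

definition has_weak_gradient ::
  "(real ^ 'd) set \<Rightarrow> (real ^ 'd \<Rightarrow> real) \<Rightarrow> (real ^ 'd \<Rightarrow> real ^ 'd) \<Rightarrow> bool" where
  "has_weak_gradient \<Omega> v G \<longleftrightarrow>
     (\<forall>\<phi>\<in>test_functions \<Omega>. \<forall>\<phi>'. (\<forall>x. GDERIV \<phi> x :> \<phi>' x) \<longrightarrow>
        (LINT x|lebesgue_on \<Omega>. v x *\<^sub>R \<phi>' x) = - (LINT x|lebesgue_on \<Omega>. \<phi> x *\<^sub>R G x))"

definition W1inf :: "(real ^ 'd) set \<Rightarrow> (real ^ 'd \<Rightarrow> real) set" where
  "W1inf \<Omega> = {v \<in> Linf_space \<Omega>. \<exists>G\<in>Linf_space \<Omega>. has_weak_gradient \<Omega> v G}"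

definition weak_grad :: "(real ^ 'd) set \<Rightarrow> (real ^ 'd \<Rightarrow> real) \<Rightarrow> real ^ 'd \<Rightarrow> real ^ 'd" where
  "weak_grad \<Omega> v = (SOME G. G \<in> Linf_space \<Omega> \<and> has_weak_gradient \<Omega> v G)"

text \<open>On a bounded Lipschitz domain every \<open>v \<in> W\<^sup>1\<^sup>,\<^sup>\<infinity>(\<Omega>)\<close> agrees almost everywhere with a
  function that is Lipschitz on \<open>closure \<Omega>\<close> (unique there); its restriction to the boundary is
  the trace of \<open>v\<close>.\<close>

definition has_trace ::
  "(real ^ 'd) set \<Rightarrow> (real ^ 'd \<Rightarrow> real) \<Rightarrow> (real ^ 'd \<Rightarrow> real) \<Rightarrow> bool" where
  "has_trace \<Omega> v V \<longleftrightarrow>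
     (\<exists>L. L-lipschitz_on (closure \<Omega>) V) \<and> (AE x in lebesgue_on \<Omega>. v x = V x)"

definition bdry_trace :: "(real ^ 'd) set \<Rightarrow> (real ^ 'd \<Rightarrow> real) \<Rightarrow> real ^ 'd \<Rightarrow> real" where
  "bdry_trace \<Omega> v = (SOME V. has_trace \<Omega> v V)"

definition trace_eq_on ::
  "(real ^ 'd) set \<Rightarrow> (real ^ 'd) set \<Rightarrow> (real ^ 'd \<Rightarrow> real) \<Rightarrow> (real ^ 'd \<Rightarrow> real) \<Rightarrow> bool" where
  "trace_eq_on \<Omega> \<Gamma> v w \<longleftrightarrow> (\<exists>V. has_trace \<Omega> v V \<and> surface_AE \<Gamma> (\<lambda>x. V x = w x))"

definition W1inf_D :: "(real ^ 'd) set \<Rightarrow> (real ^ 'd) set \<Rightarrow> (real ^ 'd \<Rightarrow> real) set" where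
  "W1inf_D \<Omega> \<Gamma>\<^sub>D = {v \<in> W1inf \<Omega>. trace_eq_on \<Omega> \<Gamma>\<^sub>D v (\<lambda>x. 0)}"

text \<open>For a relatively open part \<open>\<Gamma>\<close> of a compact Lipschitz boundary, \<open>W\<^sup>1\<^sup>,\<^sup>\<infinity>(\<Gamma>)\<close> consists of
  the functions that agree almost everywhere on \<open>\<Gamma>\<close> with a bounded function that is locally
  Lipschitz with one Lipschitz constant for all of \<open>\<Gamma>\<close>. The two constants give a norm equivalent
  to every norm defined through an atlas of the boundary; in particular functions vanishing
  almost everywhere on \<open>\<Gamma>\<close> have norm zero, so bounded functionals do not see values off \<open>\<Gamma>\<close> or
  on surface null sets.\<close>

definition surf_W1inf_bound ::
  "(real ^ 'd) set \<Rightarrow> (real ^ 'd \<Rightarrow> real) \<Rightarrow> real \<Rightarrow> real \<Rightarrow> bool" where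
  "surf_W1inf_bound \<Gamma> w B L \<longleftrightarrow> 0 \<le> B \<and> 0 \<le> L \<and>
     (\<exists>w'. surface_AE \<Gamma> (\<lambda>x. w x = w' x) \<and> (\<forall>x\<in>\<Gamma>. \<bar>w' x\<bar> \<le> B) \<and>
           (\<forall>x\<in>\<Gamma>. \<exists>\<epsilon>>0. L-lipschitz_on (\<Gamma> \<inter> ball x \<epsilon>) w'))"

definition surf_W1inf :: "(real ^ 'd) set \<Rightarrow> (real ^ 'd \<Rightarrow> real) set" where
  "surf_W1inf \<Gamma> = {w. \<exists>B L. surf_W1inf_bound \<Gamma> w B L}"

definition surf_W1inf_norm :: "(real ^ 'd) set \<Rightarrow> (real ^ 'd \<Rightarrow> real) \<Rightarrow> real" where
  "surf_W1inf_norm \<Gamma> w = Inf {B + L | B L. surf_W1inf_bound \<Gamma> w B L}"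

definition surf_W1inf_dual :: "(real ^ 'd) set \<Rightarrow> ((real ^ 'd \<Rightarrow> real) \<Rightarrow> real) set" where
  "surf_W1inf_dual \<Gamma> = {g.
     (\<forall>u\<in>surf_W1inf \<Gamma>. \<forall>w\<in>surf_W1inf \<Gamma>. g (\<lambda>x. u x + w x) = g u + g w) \<and>
     (\<forall>c. \<forall>w\<in>surf_W1inf \<Gamma>. g (\<lambda>x. c * w x) = c * g w) \<and>
     (\<exists>C. \<forall>w\<in>surf_W1inf \<Gamma>. \<bar>g w\<bar> \<le> C * surf_W1inf_norm \<Gamma> w)}"


section \<open>Finitely additive vector measures\<close>

text \<open>Set functions are total; only their values on \<open>sets (lebesgue_on \<Omega>)\<close>, the Lebesgue
  measurable subsets of \<open>\<Omega>\<close>, matter. Since set functions in \<open>ba\<close> vanish on the empty set,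
  countable partitions may be given as sequences whose members are possibly empty.\<close>

definition total_variation ::
  "(real ^ 'd) set \<Rightarrow> ((real ^ 'd) set \<Rightarrow> real ^ 'd) \<Rightarrow> (real ^ 'd) set \<Rightarrow> ennreal" where
  "total_variation \<Omega> \<nu> S =
     (SUP A\<in>{A :: nat \<Rightarrow> (real ^ 'd) set.
          range A \<subseteq> sets (lebesgue_on \<Omega>) \<and> disjoint_family A \<and> (\<Union>i. A i) = S}.
        (\<Sum>i. ennreal (norm (\<nu> (A i)))))"

definition ba :: "(real ^ 'd) set \<Rightarrow> ((real ^ 'd) set \<Rightarrow> real ^ 'd) set" where
  "ba \<Omega> = {\<nu>.
     (\<forall>A\<in>sets (lebesgue_on \<Omega>). \<forall>B\<in>sets (lebesgue_on \<Omega>).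
         A \<inter> B = {} \<longrightarrow> \<nu> (A \<union> B) = \<nu> A + \<nu> B) \<and>
     (\<forall>A\<in>null_sets (lebesgue_on \<Omega>). \<nu> A = 0) \<and>
     total_variation \<Omega> \<nu> \<Omega> < \<infinity>}"

definition simple_ba_integral ::
  "(real ^ 'd) set \<Rightarrow> ((real ^ 'd) set \<Rightarrow> real ^ 'd) \<Rightarrow> (real ^ 'd \<Rightarrow> real ^ 'd) \<Rightarrow> real" where
  "simple_ba_integral \<Omega> \<nu> s = (\<Sum>c\<in>s ` \<Omega>. c \<bullet> \<nu> (s -` {c} \<inter> \<Omega>))"

definition has_ba_integral ::
  "(real ^ 'd) set \<Rightarrow> ((real ^ 'd) set \<Rightarrow> real ^ 'd) \<Rightarrow> (real ^ 'd \<Rightarrow> real ^ 'd) \<Rightarrow> real \<Rightarrow> bool" where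
  "has_ba_integral \<Omega> \<nu> z J \<longleftrightarrow>
     (\<exists>s. (\<forall>n. simple_function (lebesgue_on \<Omega>) (s n)) \<and>
          (\<lambda>n. Linf_norm \<Omega> (\<lambda>x. s n x - z x)) \<longlonglongrightarrow> 0 \<and>
          (\<lambda>n. simple_ba_integral \<Omega> \<nu> (s n)) \<longlonglongrightarrow> J)"

definition ba_pairing ::
  "(real ^ 'd) set \<Rightarrow> ((real ^ 'd) set \<Rightarrow> real ^ 'd) \<Rightarrow> (real ^ 'd \<Rightarrow> real ^ 'd) \<Rightarrow> real" where
  "ba_pairing \<Omega> \<nu> z = (THE J. has_ba_integral \<Omega> \<nu> z J)"

text \<open>The set function \<open>A \<mapsto> \<integral>\<^sub>A \<zeta> d\<nu>\<close>, computed componentwise.\<close>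

definition scale_ba ::
  "(real ^ 'd) set \<Rightarrow> (real ^ 'd \<Rightarrow> real) \<Rightarrow> ((real ^ 'd) set \<Rightarrow> real ^ 'd)
     \<Rightarrow> (real ^ 'd) set \<Rightarrow> real ^ 'd" where
  "scale_ba \<Omega> \<zeta> \<nu> A = (\<chi> i. ba_pairing \<Omega> \<nu> (\<lambda>x. (indicator A x * \<zeta> x) *\<^sub>R axis i 1))"

text \<open>The set function that represents the functional \<open>z \<mapsto> \<integral>\<^sub>\<Omega> y \<bullet> z dx\<close>.\<close>

definition density_ba ::
  "(real ^ 'd) set \<Rightarrow> (real ^ 'd \<Rightarrow> real ^ 'd) \<Rightarrow> (real ^ 'd) set \<Rightarrow> real ^ 'd" where
  "density_ba \<Omega> y A = (LINT x|lebesgue_on \<Omega>. indicator A x *\<^sub>R y x)"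

definition singular_ba :: "(real ^ 'd) set \<Rightarrow> ((real ^ 'd) set \<Rightarrow> real ^ 'd) set" where
  "singular_ba \<Omega> = {\<nu> \<in> ba \<Omega>. \<exists>E :: nat \<Rightarrow> (real ^ 'd) set.
     range E \<subseteq> sets (lebesgue_on \<Omega>) \<and> decseq E \<and>
     (\<lambda>n. emeasure lebesgue (E n)) \<longlonglongrightarrow> 0 \<and> (\<forall>n. total_variation \<Omega> \<nu> (\<Omega> - E n) = 0)}"

definition lebesgue_decomposition ::
  "(real ^ 'd) set \<Rightarrow> ((real ^ 'd) set \<Rightarrow> real ^ 'd) \<Rightarrow> (real ^ 'd \<Rightarrow> real ^ 'd)
     \<Rightarrow> ((real ^ 'd) set \<Rightarrow> real ^ 'd) \<Rightarrow> bool" where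
  "lebesgue_decomposition \<Omega> \<nu> y \<nu>s \<longleftrightarrow> y \<in> L1_space \<Omega> \<and> \<nu>s \<in> singular_ba \<Omega> \<and>
     (\<forall>A\<in>sets (lebesgue_on \<Omega>). \<nu> A = density_ba \<Omega> y A + \<nu>s A)"

definition regular_part ::
  "(real ^ 'd) set \<Rightarrow> ((real ^ 'd) set \<Rightarrow> real ^ 'd) \<Rightarrow> real ^ 'd \<Rightarrow> real ^ 'd" where
  "regular_part \<Omega> \<nu> = (SOME y. \<exists>\<nu>s. lebesgue_decomposition \<Omega> \<nu> y \<nu>s)"

definition singular_part ::
  "(real ^ 'd) set \<Rightarrow> ((real ^ 'd) set \<Rightarrow> real ^ 'd) \<Rightarrow> (real ^ 'd) set \<Rightarrow> real ^ 'd" where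
  "singular_part \<Omega> \<nu> = (SOME \<nu>s. \<exists>y. lebesgue_decomposition \<Omega> \<nu> y \<nu>s)"


section \<open>Energy densities\<close>

definition phi :: "(real ^ 'd \<Rightarrow> real) \<Rightarrow> real ^ 'd \<Rightarrow> real ^ 'd \<Rightarrow> ereal" where
  "phi \<zeta> x t = (if norm t \<le> \<zeta> x then ereal ((norm t)\<^sup>2 / 2) else \<infinity>)"

definition phi_star :: "(real ^ 'd \<Rightarrow> real) \<Rightarrow> real ^ 'd \<Rightarrow> real ^ 'd \<Rightarrow> real" where
  "phi_star \<zeta> x s =
     (if norm s \<le> \<zeta> x then (norm s)\<^sup>2 / 2 else \<zeta> x * norm s - (\<zeta> x)\<^sup>2 / 2)"

lemma phi_star_fenchel_conjugate:
  assumes "0 \<le> \<zeta> x"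
  shows "ereal (phi_star \<zeta> x s) = (SUP t. ereal (t \<bullet> s) - phi \<zeta> x t)"
proof (rule antisym)
  show "(SUP t. ereal (t \<bullet> s) - phi \<zeta> x t) \<le> ereal (phi_star \<zeta> x s)"
  proof (rule SUP_least)
    fix t
    show "ereal (t \<bullet> s) - phi \<zeta> x t \<le> ereal (phi_star \<zeta> x s)"
    proof (cases "norm t \<le> \<zeta> x")
      case True
      have 1: "t \<bullet> s \<le> norm t * norm s"
        by (rule norm_cauchy_schwarz)
      have 2: "norm t * norm s - (norm t)\<^sup>2 / 2 \<le> (norm s)\<^sup>2 / 2"
        using sum_squares_bound[of "norm t" "norm s"] by simp
      have 3: "norm t * norm s - (norm t)\<^sup>2 / 2 \<le> \<zeta> x * norm s - (\<zeta> x)\<^sup>2 / 2"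
        if "\<zeta> x < norm s"
      proof -
        have "0 \<le> (\<zeta> x - norm t) * (2 * norm s - \<zeta> x - norm t)"
          using True that by (intro mult_nonneg_nonneg) auto
        then show ?thesis
          by (simp add: algebra_simps power2_eq_square)
      qed
      show ?thesis
        using True 1 2 3 by (auto simp: phi_def phi_star_def)
    qed (simp add: phi_def)
  qed
next
  define t where "t = (if norm s \<le> \<zeta> x then s else (\<zeta> x / norm s) *\<^sub>R s)"
  have "ereal (phi_star \<zeta> x s) = ereal (t \<bullet> s) - phi \<zeta> x t"
  proof (cases "norm s \<le> \<zeta> x")
    case True
    then show ?thesis
      by (simp add: t_def phi_def phi_star_def dot_square_norm)
  next
    case False
    then have s: "norm s > 0"
      using assms by linarith
    then have "norm t = \<zeta> x" "t \<bullet> s = \<zeta> x * norm s"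
      using assms False by (auto simp: t_def dot_square_norm power2_eq_square)
    then show ?thesis
      using False by (simp add: phi_def phi_star_def)
  qed
  also have "\<dots> \<le> (SUP t. ereal (t \<bullet> s) - phi \<zeta> x t)"
    by (rule SUP_upper) simp
  finally show "ereal (phi_star \<zeta> x s) \<le> (SUP t. ereal (t \<bullet> s) - phi \<zeta> x t)" .
qed

text \<open>Lebesgue integral of an extended real function as the difference of the integrals of its
  positive and negative parts.\<close>

definition ereal_integral :: "'a measure \<Rightarrow> ('a \<Rightarrow> ereal) \<Rightarrow> ereal" where
  "ereal_integral M h =
     enn2ereal (\<integral>\<^sup>+x. e2ennreal (h x) \<partial>M) - enn2ereal (\<integral>\<^sup>+x. e2ennreal (- h x) \<partial>M)"


section \<open>Primal and dual problem\<close>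

definition load ::
  "(real ^ 'd) set \<Rightarrow> (real ^ 'd \<Rightarrow> real) \<Rightarrow> ((real ^ 'd \<Rightarrow> real) \<Rightarrow> real)
     \<Rightarrow> (real ^ 'd \<Rightarrow> real) \<Rightarrow> real" where
  "load \<Omega> f g v = (LINT x|lebesgue_on \<Omega>. f x * v x) + g (bdry_trace \<Omega> v)"

definition primal_admissible ::
  "(real ^ 'd) set \<Rightarrow> (real ^ 'd) set \<Rightarrow> (real ^ 'd \<Rightarrow> real) \<Rightarrow> (real ^ 'd \<Rightarrow> real)
     \<Rightarrow> (real ^ 'd \<Rightarrow> real) set" where
  "primal_admissible \<Omega> \<Gamma>\<^sub>D \<zeta> u\<^sub>D = {v \<in> W1inf \<Omega>.
     (AE x in lebesgue_on \<Omega>. norm (weak_grad \<Omega> v x) \<le> \<zeta> x) \<and> trace_eq_on \<Omega> \<Gamma>\<^sub>D v u\<^sub>D}"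

definition primal_functional ::
  "(real ^ 'd) set \<Rightarrow> (real ^ 'd) set \<Rightarrow> (real ^ 'd \<Rightarrow> real) \<Rightarrow> (real ^ 'd \<Rightarrow> real)
     \<Rightarrow> (real ^ 'd \<Rightarrow> real) \<Rightarrow> ((real ^ 'd \<Rightarrow> real) \<Rightarrow> real) \<Rightarrow> (real ^ 'd \<Rightarrow> real) \<Rightarrow> ereal" where
  "primal_functional \<Omega> \<Gamma>\<^sub>D \<zeta> u\<^sub>D f g v =
     (if v \<in> primal_admissible \<Omega> \<Gamma>\<^sub>D \<zeta> u\<^sub>D
      then ereal ((LINT x|lebesgue_on \<Omega>. (norm (weak_grad \<Omega> v x))\<^sup>2) / 2 - load \<Omega> f g v)
      else \<infinity>)"

definition dual_admissible ::
  "(real ^ 'd) set \<Rightarrow> (real ^ 'd) set \<Rightarrow> (real ^ 'd \<Rightarrow> real) \<Rightarrow> ((real ^ 'd \<Rightarrow> real) \<Rightarrow> real)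
     \<Rightarrow> ((real ^ 'd) set \<Rightarrow> real ^ 'd) set" where
  "dual_admissible \<Omega> \<Gamma>\<^sub>D f g =
     {\<nu> \<in> ba \<Omega>. \<forall>v\<in>W1inf_D \<Omega> \<Gamma>\<^sub>D. ba_pairing \<Omega> \<nu> (weak_grad \<Omega> v) = load \<Omega> f g v}"

definition dual_functional ::
  "(real ^ 'd) set \<Rightarrow> (real ^ 'd) set \<Rightarrow> (real ^ 'd \<Rightarrow> real) \<Rightarrow> (real ^ 'd \<Rightarrow> real)
     \<Rightarrow> (real ^ 'd \<Rightarrow> real) \<Rightarrow> ((real ^ 'd \<Rightarrow> real) \<Rightarrow> real)
     \<Rightarrow> ((real ^ 'd) set \<Rightarrow> real ^ 'd) \<Rightarrow> ereal" where
  "dual_functional \<Omega> \<Gamma>\<^sub>D \<zeta> uhat f g \<nu> =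
     (if \<nu> \<in> dual_admissible \<Omega> \<Gamma>\<^sub>D f g
      then ereal (- (LINT x|lebesgue_on \<Omega>. phi_star \<zeta> x (regular_part \<Omega> \<nu> x))
                  - enn2real (total_variation \<Omega> (scale_ba \<Omega> \<zeta> (singular_part \<Omega> \<nu>)) \<Omega>)
                  + ba_pairing \<Omega> \<nu> (weak_grad \<Omega> uhat) - load \<Omega> f g uhat)
      else - \<infinity>)"

definition gap_estimator ::
  "(real ^ 'd) set \<Rightarrow> (real ^ 'd) set \<Rightarrow> (real ^ 'd \<Rightarrow> real) \<Rightarrow> (real ^ 'd \<Rightarrow> real)
     \<Rightarrow> (real ^ 'd \<Rightarrow> real) \<Rightarrow> (real ^ 'd \<Rightarrow> real) \<Rightarrow> ((real ^ 'd \<Rightarrow> real) \<Rightarrow> real)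
     \<Rightarrow> (real ^ 'd \<Rightarrow> real) \<Rightarrow> ((real ^ 'd) set \<Rightarrow> real ^ 'd) \<Rightarrow> ereal" where
  "gap_estimator \<Omega> \<Gamma>\<^sub>D \<zeta> u\<^sub>D uhat f g v \<nu> =
     primal_functional \<Omega> \<Gamma>\<^sub>D \<zeta> u\<^sub>D f g v - dual_functional \<Omega> \<Gamma>\<^sub>D \<zeta> uhat f g \<nu>"

definition gap_estimator_A ::
  "(real ^ 'd) set \<Rightarrow> (real ^ 'd \<Rightarrow> real) \<Rightarrow> (real ^ 'd \<Rightarrow> real)
     \<Rightarrow> (real ^ 'd \<Rightarrow> real ^ 'd) \<Rightarrow> ereal" where
  "gap_estimator_A \<Omega> \<zeta> v y =
     ereal_integral (lebesgue_on \<Omega>)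
       (\<lambda>x. phi \<zeta> x (weak_grad \<Omega> v x) - ereal (weak_grad \<Omega> v x \<bullet> y x) + ereal (phi_star \<zeta> x (y x)))"

definition gap_estimator_B ::
  "(real ^ 'd) set \<Rightarrow> (real ^ 'd \<Rightarrow> real) \<Rightarrow> (real ^ 'd \<Rightarrow> real)
     \<Rightarrow> ((real ^ 'd) set \<Rightarrow> real ^ 'd) \<Rightarrow> real" where
  "gap_estimator_B \<Omega> \<zeta> v \<nu>s =
     enn2real (total_variation \<Omega> (scale_ba \<Omega> \<zeta> \<nu>s) \<Omega>) - ba_pairing \<Omega> \<nu>s (weak_grad \<Omega> v)"

end

theory Submission
  imports Defs "HOL-Computational_Algebra.Polynomial"
begin

text \<open>Why the identity holds. Both \<open>v\<close> and \<open>uhat\<close> have trace \<open>u\<^sub>D\<close> on \<open>\<Gamma>\<^sub>D\<close>, so \<open>v - uhat\<close> is an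
  admissible test function in the equilibrium condition that defines \<open>K\<^sup>*\<close>:
  \<open>\<langle>\<nu>, \<nabla>v\<rangle> - \<langle>\<nu>, \<nabla>uhat\<rangle> = load v - load uhat\<close>. Substituting this into \<open>I v - D \<nu>\<close> removes every
  occurrence of the load and of \<open>uhat\<close> and leaves
  \<open>\<integral> |\<nabla>v|\<^sup>2/2 + \<integral> \<phi>\<^sup>*(y) + |\<zeta> \<nu>\<^sup>s|(\<Omega>) - \<langle>\<nu>, \<nabla>v\<rangle>\<close>. Since \<open>\<langle>\<nu>, \<nabla>v\<rangle> = \<integral> \<nabla>v \<bullet> y + \<langle>\<nu>\<^sup>s, \<nabla>v\<rangle>\<close>, sorting the
  terms by \<open>y\<close> and \<open>\<nu>\<^sup>s\<close> gives the two summands; in the first one \<open>\<phi>(\<nabla>v)\<close> is finite almost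
  everywhere because of the gradient constraint.

  What makes this more than algebra is that the objects involved are chosen representatives: the
  weak gradient, the boundary trace, the pairing and the two parts of the Lebesgue decomposition
  are selected by description operators. The computation is legitimate because each of them is
  unique where it matters, and because gradient, trace and pairing depend linearly on their argument.

   \<^item> Weak gradients are unique almost everywhere (\<open>has_weak_gradient_unique\<close>) by the fundamental
     lemma of the calculus of variations (\<open>AE_0_if_test_integrals_0\<close>), for which smooth compactly
     supported functions approximating indicators of boxes are constructed.

   \<^item> The pairing of a finitely additive measure with an essentially bounded field exists, is
     unique, linear and insensitive to null sets (\<open>has_ba_integral_exists\<close>,
     \<open>has_ba_integral_unique\<close>, \<open>ba_pairing_diff\<close>, \<open>ba_pairing_AE_cong\<close>), because the integral of
     simple fields is bounded by the essential supremum times the total variation.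

   \<^item> The regular part of the Lebesgue decomposition is unique almost everywhere and the singular
     part is unique on measurable sets (\<open>lebesgue_decomposition_unique\<close>).

   \<^item> Traces are unique on the closed domain (\<open>has_trace_unique\<close>), so that the load is linear
     (\<open>load_diff\<close>).\<close>

section \<open>Smooth approximation of indicators of boxes\<close>

text \<open>With \<open>p = 1\<close> this is the standard smooth function \<open>exp (-1/t)\<close> that is flat at the origin. The
  polynomial factor makes the family closed under differentiation, so that smoothness of every
  member follows from one derivative computation.\<close>

definition flat_exp :: "real poly \<Rightarrow> real \<Rightarrow> real" where
  "flat_exp p t = (if 0 < t then poly p (inverse t) * exp (- inverse t) else 0)"

text \<open>Substituting \<open>s = 1/t\<close>, this is the decay of \<open>p s / exp s\<close> at infinity.\<close>

lemma flat_exp_tendsto_0: "(flat_exp p \<longlongrightarrow> 0) (at_right 0)"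
proof -
  have "((\<lambda>s. \<Sum>i\<le>degree p. coeff p i * (s ^ i / exp s)) \<longlongrightarrow> (\<Sum>i\<le>degree p. coeff p i * 0)) at_top"
    by (intro tendsto_intros tendsto_power_div_exp_0)
  then have "((\<lambda>s. poly p s * exp (- s)) \<longlongrightarrow> 0) at_top"
    by (simp add: poly_altdef exp_minus sum_distrib_right divide_inverse mult.assoc)
  moreover have "\<forall>\<^sub>F s :: real in at_top. poly p s * exp (- s) = flat_exp p (inverse s)"
    using eventually_gt_at_top[of "0::real"] by eventually_elim (simp add: flat_exp_def)
  ultimately have "((\<lambda>s. flat_exp p (inverse s)) \<longlongrightarrow> 0) at_top"
    by (simp add: tendsto_cong)
  then show ?thesis
    by (simp add: filterlim_at_right_to_top)
qed

text \<open>Away from the origin this is the chain rule for \<open>p (1/t) exp (-1/t)\<close>. At the origin, the right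
  difference quotient of \<open>flat_exp p\<close> is itself a member of the family, for the polynomial
  \<open>t \<mapsto> t * p t\<close>, and hence tends to zero.\<close>

lemma DERIV_flat_exp:
  "DERIV (flat_exp p) t :> flat_exp ([:0, 0, 1:] * (p - pderiv p)) t"
proof (cases t "0::real" rule: linorder_cases)
  case less
  have "DERIV (\<lambda>t. 0) t :> (0::real)" by simp
  then have "DERIV (flat_exp p) t :> 0"
    by (rule has_field_derivative_transform_within_open[where S = "{..<0}"])
       (use less in \<open>auto simp: flat_exp_def\<close>)
  with less show ?thesis by (simp add: flat_exp_def)
next
  case greater
  have "DERIV (\<lambda>t. poly p (inverse t) * exp (- inverse t)) t :>
          flat_exp ([:0, 0, 1:] * (p - pderiv p)) t"
    using greater
    by (auto intro!: derivative_eq_intros DERIV_chain2[OF poly_DERIV]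
        simp: flat_exp_def algebra_simps power2_eq_square)
  then show ?thesis
    by (rule has_field_derivative_transform_within_open[where S = "{0<..}"])
       (use greater in \<open>auto simp: flat_exp_def\<close>)
next
  case equal
  have "((\<lambda>h. (flat_exp p (0 + h) - flat_exp p 0) / h) \<longlongrightarrow> 0) (at_left 0)"
    by (rule tendsto_eventually, rule eventually_at_leftI[of "-1"]) (auto simp: flat_exp_def)
  moreover have "((\<lambda>h. (flat_exp p (0 + h) - flat_exp p 0) / h) \<longlongrightarrow> 0) (at_right 0)"
  proof (rule Lim_transform_eventually[OF flat_exp_tendsto_0[of "pCons 0 p"]])
    show "\<forall>\<^sub>F h in at_right 0. flat_exp (pCons 0 p) h = (flat_exp p (0 + h) - flat_exp p 0) / h"
      by (rule eventually_at_rightI[of 0 1]) (auto simp: flat_exp_def divide_inverse)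
  qed
  ultimately have "((\<lambda>h. (flat_exp p (0 + h) - flat_exp p 0) / h) \<longlongrightarrow> 0) (at 0)"
    by (simp add: filterlim_split_at)
  with equal show ?thesis
    by (simp add: DERIV_def flat_exp_def)
qed

lemma Ck_const: "Ck k (\<lambda>x. c)"
proof (induction k arbitrary: c)
  case (Suc k)
  then show ?case
    unfolding Ck.simps by (intro exI[of _ "\<lambda>x. 0"]) (simp add: GDERIV_const)
qed simp

lemma Ck_SucD: "Ck (Suc k) \<phi> \<Longrightarrow> Ck k \<phi>"
proof (induction k arbitrary: \<phi>)
  case 0
  then obtain \<phi>' where "\<And>x. GDERIV \<phi> x :> \<phi>' x" by auto
  then have "continuous_on UNIV \<phi>"
    unfolding gderiv_def by (intro has_derivative_continuous_on)
  then show ?case by simp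
next
  case (Suc k)
  then obtain \<phi>' where "\<And>x. GDERIV \<phi> x :> \<phi>' x" "\<And>i. Ck (Suc k) (\<lambda>x. \<phi>' x $ i)"
    unfolding Ck.simps(2)[of "Suc k"] by blast
  moreover from this(2) have "Ck k (\<lambda>x. \<phi>' x $ i)" for i
    by (rule Suc.IH)
  ultimately show ?case by auto
qed

lemma Ck_add: "Ck k \<phi> \<Longrightarrow> Ck k \<psi> \<Longrightarrow> Ck k (\<lambda>x. \<phi> x + \<psi> x)"
proof (induction k arbitrary: \<phi> \<psi>)
  case 0
  then show ?case by (auto intro: continuous_intros)
next
  case (Suc k)
  then obtain \<phi>' \<psi>' where "\<And>x. GDERIV \<phi> x :> \<phi>' x" "\<And>i. Ck k (\<lambda>x. \<phi>' x $ i)"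
      "\<And>x. GDERIV \<psi> x :> \<psi>' x" "\<And>i. Ck k (\<lambda>x. \<psi>' x $ i)"
    by auto
  with Suc.IH show ?case
    by (auto intro!: exI[of _ "\<lambda>x. \<phi>' x + \<psi>' x"] GDERIV_add)
qed

lemma Ck_mult: "Ck k \<phi> \<Longrightarrow> Ck k \<psi> \<Longrightarrow> Ck k (\<lambda>x. \<phi> x * \<psi> x)"
proof (induction k arbitrary: \<phi> \<psi>)
  case 0
  then show ?case by (auto intro: continuous_intros)
next
  case (Suc k)
  then obtain \<phi>' \<psi>' where "\<And>x. GDERIV \<phi> x :> \<phi>' x" "\<And>i. Ck k (\<lambda>x. \<phi>' x $ i)"
      "\<And>x. GDERIV \<psi> x :> \<psi>' x" "\<And>i. Ck k (\<lambda>x. \<psi>' x $ i)"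
    by auto
  moreover have "Ck k \<phi>" "Ck k \<psi>"
    using Suc.prems by (auto simp del: Ck.simps intro: Ck_SucD)
  ultimately show ?case
    using Suc.IH
    by (auto intro!: exI[of _ "\<lambda>x. \<phi> x *\<^sub>R \<psi>' x + \<psi> x *\<^sub>R \<phi>' x"] GDERIV_mult Ck_add)
qed

lemma Ck_prod: "finite I \<Longrightarrow> (\<And>i. i \<in> I \<Longrightarrow> Ck k (\<phi> i)) \<Longrightarrow> Ck k (\<lambda>x. \<Prod>i\<in>I. \<phi> i x)"
  by (induction I rule: finite_induct) (auto intro: Ck_const Ck_mult)

text \<open>The induction is over the order of differentiability for all polynomials at once: each component
  of the gradient is again a function of this form, with a polynomial that absorbs the factor \<open>c\<close>.\<close>

lemma Ck_flat_exp_coordinate: "Ck k (\<lambda>x :: real ^ 'd. flat_exp p (c * x $ i + b))"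
proof (induction k arbitrary: p)
  case 0
  have "continuous_on UNIV (flat_exp p)"
    by (rule DERIV_continuous_on[OF DERIV_flat_exp])
  then show ?case
    by (auto intro!: continuous_on_compose2[of UNIV "flat_exp p"] continuous_intros)
next
  case (Suc k)
  let ?q = "[:0, 0, 1:] * (p - pderiv p)"
  let ?l = "\<lambda>x :: real ^ 'd. c * x $ i + b"
  have "GDERIV ?l x :> c *\<^sub>R axis i 1" for x
    unfolding gderiv_def
    by (auto intro!: derivative_eq_intros bounded_linear_imp_has_derivative
        bounded_linear_vec_nth simp: inner_axis)
  then have "GDERIV (\<lambda>x. flat_exp p (?l x)) x :> flat_exp ?q (?l x) *\<^sub>R c *\<^sub>R axis i 1" for x
    by (rule GDERIV_DERIV_compose) (rule DERIV_flat_exp)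
  moreover have "(\<lambda>x. (flat_exp ?q (?l x) *\<^sub>R c *\<^sub>R axis i 1) $ j)
      = (\<lambda>x. flat_exp (smult (c * axis i 1 $ j) ?q) (?l x))" for j
    by (auto simp: flat_exp_def fun_eq_iff algebra_simps simp del: mult_pCons_left)
  ultimately show ?case
    using Suc.IH by (auto intro!: exI[of _ "\<lambda>x. flat_exp ?q (?l x) *\<^sub>R c *\<^sub>R axis i 1"]
        simp del: mult_pCons_left scaleR_scaleR vector_scaleR_component)
qed

text \<open>For fixed \<open>t > 0\<close> one has \<open>flat_exp 1 (n t) = exp (-1/(n t))\<close>, which increases to \<open>1\<close>, while the
  value stays \<open>0\<close> for \<open>t \<le> 0\<close>. The product over both faces in each direction therefore increases to
  the indicator of the open box without leaving its support.\<close>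

definition box_bump :: "real ^ 'd \<Rightarrow> real ^ 'd \<Rightarrow> nat \<Rightarrow> real ^ 'd \<Rightarrow> real" where
  "box_bump a b n x =
     (\<Prod>i\<in>UNIV. flat_exp 1 (real n * x $ i + - (real n * a $ i))
               * flat_exp 1 (- real n * x $ i + real n * b $ i))"

lemma flat_exp_1_bounds: "0 \<le> flat_exp 1 t" "flat_exp 1 t \<le> 1"
  by (auto simp: flat_exp_def)

lemma box_bump_bounds: "\<bar>box_bump a b n x\<bar> \<le> 1"
  by (auto simp: box_bump_def abs_prod abs_mult flat_exp_1_bounds intro!: prod_le_1 mult_le_one)

lemma box_bump_eq_0: "x \<notin> box a b \<Longrightarrow> box_bump a b n x = 0"
proof -
  assume "x \<notin> box a b"
  then obtain i where "x $ i \<le> a $ i \<or> b $ i \<le> x $ i"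
    by (auto simp: mem_box_cart not_less)
  then have "real n * x $ i \<le> real n * a $ i \<or> real n * b $ i \<le> real n * x $ i"
    by (auto intro: mult_left_mono)
  then have "flat_exp 1 (real n * x $ i + - (real n * a $ i)) * flat_exp 1 (- real n * x $ i + real n * b $ i) = 0"
    by (auto simp: flat_exp_def)
  then show ?thesis
    unfolding box_bump_def by (intro prod_zero) auto
qed

lemma flat_exp_1_scaled_tendsto: "0 < t \<Longrightarrow> (\<lambda>n. flat_exp 1 (real n * t)) \<longlonglongrightarrow> 1"
proof -
  assume t: "0 < t"
  have "(\<lambda>n. exp (- (inverse (real n) * inverse t))) \<longlonglongrightarrow> exp (- (0 * inverse t))"
    by (intro tendsto_intros lim_inverse_n)
  moreover have "\<forall>\<^sub>F n in sequentially. exp (- (inverse (real n) * inverse t)) = flat_exp 1 (real n * t)"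
    using eventually_gt_at_top[of "0::nat"]
    by eventually_elim (use t in \<open>simp add: flat_exp_def\<close>)
  ultimately show ?thesis
    by (simp add: tendsto_cong)
qed

lemma box_bump_tendsto: "(\<lambda>n. box_bump a b n x) \<longlonglongrightarrow> indicator (box a b) x"
proof (cases "x \<in> box a b")
  case True
  then have "(\<lambda>n. \<Prod>i\<in>UNIV. flat_exp 1 (real n * (x $ i - a $ i))
               * flat_exp 1 (real n * (b $ i - x $ i))) \<longlonglongrightarrow> (\<Prod>i\<in>(UNIV :: 'a set). 1 * 1)"
    by (intro tendsto_prod tendsto_mult flat_exp_1_scaled_tendsto) (auto simp: mem_box_cart)
  with True show ?thesis
    by (simp add: box_bump_def algebra_simps)
qed (simp add: box_bump_eq_0)

lemma box_bump_test_function: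
  assumes "cbox a b \<subseteq> \<Omega>"
  shows "box_bump a b n \<in> test_functions \<Omega>"
proof -
  have supp: "closure {x. box_bump a b n x \<noteq> 0} \<subseteq> cbox a b"
    using box_subset_cbox box_bump_eq_0 by (intro closure_minimal closed_cbox) blast
  then have "compact (closure {x. box_bump a b n x \<noteq> 0})"
    using compact_cbox closed_closure compact_Int_closed by (metis inf.absorb2)
  moreover have "Ck k (box_bump a b n)" for k
    unfolding box_bump_def[abs_def]
    by (intro Ck_prod Ck_mult Ck_flat_exp_coordinate) auto
  ultimately show ?thesis
    using supp assms by (auto simp: test_functions_def)
qed

section \<open>Test functions and their gradients\<close>

text \<open>Differentiability of order one already makes the gradient continuous, hence bounded on a bounded
  domain; this is what makes the integrals in the definition of a weak gradient converge.\<close>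

lemma test_functionE:
  assumes "\<phi> \<in> test_functions \<Omega>"
  obtains \<phi>' where "\<And>x. GDERIV \<phi> x :> \<phi>' x" "continuous_on UNIV \<phi>" "continuous_on UNIV \<phi>'"
proof -
  have "Ck (Suc 0) \<phi>" using assms by (simp add: test_functions_def)
  then obtain \<phi>' where D: "\<And>x. GDERIV \<phi> x :> \<phi>' x" "\<And>i. continuous_on UNIV (\<lambda>x. \<phi>' x $ i)"
    by auto
  have "continuous_on UNIV (\<lambda>x. \<chi> i. \<phi>' x $ i)"
    using D(2) by (rule continuous_on_vec_lambda)
  then have "continuous_on UNIV \<phi>'" by simp
  moreover have "continuous_on UNIV \<phi>"
    using Ck_SucD[OF \<open>Ck (Suc 0) \<phi>\<close>] by simp
  ultimately show ?thesis using that D(1) by blast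
qed

lemma GDERIV_unique: "GDERIV f x :> D \<Longrightarrow> GDERIV f x :> D' \<Longrightarrow> D = D'"
proof -
  assume "GDERIV f x :> D" "GDERIV f x :> D'"
  then have "(\<lambda>h. h \<bullet> D) = (\<lambda>h. h \<bullet> D')"
    unfolding gderiv_def by (rule has_derivative_unique)
  then have "(D - D') \<bullet> D = (D - D') \<bullet> D'" by (rule fun_cong)
  then have "(D - D') \<bullet> (D - D') = 0" by (simp add: inner_diff_right)
  then show "D = D'" by simp
qed

section \<open>Functions with vanishing integrals over boxes\<close>

lemma sigma_finite_lebesgue: "sigma_finite_measure (lebesgue :: 'a::euclidean_space measure)"
proof -
  obtain A :: "'a set set" where "countable A" "A \<subseteq> sets lborel" "\<Union>A = space lborel"
      "\<forall>a\<in>A. emeasure lborel a \<noteq> \<infinity>"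
    using lborel.sigma_finite_countable by blast
  then show ?thesis
    by (intro sigma_finite_measure.intro exI[of _ A]) auto
qed

text \<open>Boxes form an intersection-stable generator of the Borel sets, and a Lebesgue measurable set is a
  Borel set up to a null set. Because \<open>h\<close> vanishes off \<open>box c d\<close>, the complement of a set is
  handled by subtracting from the integral over \<open>box c d\<close>.\<close>

lemma lebesgue_AE_0_if_box_integrals_0:
  fixes h :: "'a::euclidean_space \<Rightarrow> 'b::{second_countable_topology, banach}"
  assumes h: "integrable lebesgue h"
    and out: "\<And>x. x \<notin> box c d \<Longrightarrow> h x = 0"
    and boxes: "\<And>a b. box a b \<subseteq> box c d \<Longrightarrow> (LINT x|lebesgue. indicator (box a b) x *\<^sub>R h x) = 0"
  shows "AE x in lebesgue. h x = 0"
proof (rule sigma_finite_measure.density_zero[OF sigma_finite_lebesgue h])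
  define I where "I A = (LINT x|lebesgue. indicator A x *\<^sub>R h x)" for A
  have int: "integrable lebesgue (\<lambda>x. indicator A x *\<^sub>R h x)" if "A \<in> sets lebesgue" for A
    using that h by (rule integrable_mult_indicator)
  have borel: "I A = 0" if "A \<in> sets borel" for A
  proof -
    have "Int_stable (range (\<lambda>(a, b). box a b :: 'a set))"
      by (auto simp: Int_stable_def box_Int_box)
    moreover have "range (\<lambda>(a, b). box a b :: 'a set) \<subseteq> Pow UNIV" by simp
    moreover have "A \<in> sigma_sets UNIV (range (\<lambda>(a, b). box a b :: 'a set))"
      using that by (simp add: borel_eq_box)
    ultimately show ?thesis
    proof (induction rule: sigma_sets_induct_disjoint)
      case (basic A)
      then obtain a b where A: "A = box a b" by auto
      \<comment> \<open>Intersecting with \<open>box c d\<close> brings an arbitrary box within reach of the hypothesis.\<close>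
      obtain a' b' where ab: "box a b \<inter> box c d = box a' b'"
        using box_Int_box by blast
      have "I A = (LINT x|lebesgue. indicator (box a' b') x *\<^sub>R h x)"
        unfolding I_def A ab[symmetric]
        by (intro Bochner_Integration.integral_cong refl) (auto simp: indicator_def out)
      also have "\<dots> = 0" using ab by (intro boxes) auto
      finally show ?case .
    next
      case empty
      show ?case by (simp add: I_def)
    next
      case (compl A)
      then have A: "A \<in> sets lebesgue"
        by (metis borel_eq_box sets_completionI_sets sets_lborel sets_measure_of space_borel top_greatest Pow_UNIV)
      have "I (box c d) - I A
          = (LINT x|lebesgue. indicator (box c d) x *\<^sub>R h x - indicator A x *\<^sub>R h x)"
        unfolding I_def using int[OF A] int[of "box c d"]
        by (intro Bochner_Integration.integral_diff[symmetric]) auto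
      also have "\<dots> = I (UNIV - A)"
        unfolding I_def
        by (intro Bochner_Integration.integral_cong refl) (auto simp: indicator_def out)
      finally have "I (UNIV - A) = I (box c d) - I A" ..
      with compl boxes[of c d] show ?case by (simp add: I_def)
    next
      case (union A)
      have A: "A i \<in> sets lebesgue" for i
        using union(2)
        by (metis borel_eq_box range_subsetD sets_completionI_sets sets_lborel sets_measure_of space_borel top_greatest Pow_UNIV)
      have "set_lebesgue_integral lebesgue (\<Union>i. A i) h = (\<Sum>i. set_lebesgue_integral lebesgue (A i) h)"
        using union(1) A int[of "\<Union>i. A i"]
        by (intro lebesgue_integral_countable_add)
           (auto simp: disjoint_family_on_def set_integrable_def)
      with union show ?case by (simp add: I_def set_lebesgue_integral_def)
    qed
  qed
  fix A :: "'a set" assume A: "A \<in> sets lebesgue"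
  then obtain S N where S: "S \<in> sets borel" "A = S \<union> N" "N \<in> null_sets lebesgue"
    by (metis sets_completionE null_sets_completionI null_sets_completion_iff2 sets_lborel)
  then have "AE x in lebesgue. indicator A x *\<^sub>R h x = indicator S x *\<^sub>R h x"
    by (auto simp: indicator_def elim!: eventually_mono dest!: AE_not_in)
  then have "I A = I S"
    unfolding I_def using int[OF A] int[of S] S(1)
    by (intro integral_cong_AE) (auto dest: borel_measurable_integrable)
  then show "set_lebesgue_integral lebesgue A h = 0"
    using borel[OF S(1)] by (simp add: I_def set_lebesgue_integral_def)
qed

section \<open>Essentially bounded functions\<close>

lemma AE_norm_le_Linf_norm: "AE x in lebesgue_on \<Omega>. ereal (norm (f x)) \<le> Linf_norm \<Omega> f"
  unfolding Linf_norm_def by (rule esssup_AE)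

lemma Linf_norm_leI:
  assumes "f \<in> borel_measurable (lebesgue_on \<Omega>)" "AE x in lebesgue_on \<Omega>. norm (f x) \<le> C"
  shows "Linf_norm \<Omega> f \<le> ereal C"
  unfolding Linf_norm_def using assms by (intro esssup_I) auto

lemma Linf_spaceI:
  assumes "f \<in> borel_measurable (lebesgue_on \<Omega>)" "AE x in lebesgue_on \<Omega>. norm (f x) \<le> C"
  shows "f \<in> Linf_space \<Omega>"
  using assms Linf_norm_leI[OF assms] by (auto simp: Linf_space_def)

lemma Linf_spaceE:
  assumes "f \<in> Linf_space \<Omega>"
  obtains C where "0 \<le> C" "AE x in lebesgue_on \<Omega>. norm (f x) \<le> C"
proof -
  obtain C where C: "Linf_norm \<Omega> f \<le> ereal C"
    using assms by (cases "Linf_norm \<Omega> f") (auto simp: Linf_space_def)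
  have "AE x in lebesgue_on \<Omega>. norm (f x) \<le> max 0 C"
    using AE_norm_le_Linf_norm[of f \<Omega>]
  proof eventually_elim
    case (elim x)
    then have "ereal (norm (f x)) \<le> ereal C" using C by (rule order_trans)
    then show ?case by auto
  qed
  then show ?thesis by (intro that[of "max 0 C"]) auto
qed

lemma Linf_space_measurable: "f \<in> Linf_space \<Omega> \<Longrightarrow> f \<in> borel_measurable (lebesgue_on \<Omega>)"
  by (simp add: Linf_space_def)

lemma Linf_space_diff:
  assumes "f \<in> Linf_space \<Omega>" "h \<in> Linf_space \<Omega>"
  shows "(\<lambda>x. f x - h x) \<in> Linf_space \<Omega>"
proof -
  obtain B C where B: "AE x in lebesgue_on \<Omega>. norm (f x) \<le> B"
      and C: "AE x in lebesgue_on \<Omega>. norm (h x) \<le> C"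
    using assms by (metis Linf_spaceE)
  have "AE x in lebesgue_on \<Omega>. norm (f x - h x) \<le> B + C"
    using B C by eventually_elim (metis add_mono norm_triangle_ineq4 order_trans)
  then show ?thesis
    using assms by (intro Linf_spaceI) (auto intro: Linf_space_measurable borel_measurable_diff)
qed

lemma Linf_norm_tendsto_0D:
  assumes "(\<lambda>n. Linf_norm \<Omega> (w n)) \<longlonglongrightarrow> 0" "\<epsilon> > 0"
  shows "\<forall>\<^sub>F n in sequentially. AE x in lebesgue_on \<Omega>. norm (w n x) \<le> \<epsilon>"
proof -
  have "\<forall>\<^sub>F n in sequentially. Linf_norm \<Omega> (w n) < ereal \<epsilon>"
    using assms by (intro order_tendstoD(2)) auto
  then show ?thesis
  proof eventually_elim
    case (elim n)
    show ?case
      using AE_norm_le_Linf_norm[of "w n" \<Omega>]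
    proof eventually_elim
      case (elim x)
      then have "ereal (norm (w n x)) < ereal \<epsilon>"
        using \<open>Linf_norm \<Omega> (w n) < ereal \<epsilon>\<close> by (rule le_less_trans)
      then show ?case by simp
    qed
  qed
qed

text \<open>On a null set the essential supremum is \<open>-\<infinity>\<close> and never tends to \<open>0\<close>, which is why the domain has
  to have positive measure here and in all existence results for the pairing below.\<close>

lemma Linf_norm_tendsto_0I:
  assumes nonnull: "emeasure (lebesgue_on \<Omega>) \<Omega> \<noteq> 0"
    and meas: "\<And>n. w n \<in> borel_measurable (lebesgue_on \<Omega>)"
    and small: "\<And>\<epsilon>. \<epsilon> > 0 \<Longrightarrow> \<forall>\<^sub>F n in sequentially. AE x in lebesgue_on \<Omega>. norm (w n x) \<le> \<epsilon>"
  shows "(\<lambda>n. Linf_norm \<Omega> (w n)) \<longlonglongrightarrow> 0"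
proof (rule order_tendstoI)
  have nonneg: "0 \<le> Linf_norm \<Omega> (w n)" for n
  proof -
    have "0 = esssup (lebesgue_on \<Omega>) (\<lambda>x. 0 :: ereal)"
      using nonnull by (simp add: esssup_const)
    also have "\<dots> \<le> Linf_norm \<Omega> (w n)"
      unfolding Linf_norm_def by (rule esssup_mono) auto
    finally show ?thesis .
  qed
  fix a :: ereal assume "a < 0"
  then show "\<forall>\<^sub>F n in sequentially. a < Linf_norm \<Omega> (w n)"
    using less_le_trans[OF _ nonneg] by simp
next
  fix a :: ereal assume "0 < a"
  then obtain r where r: "0 < ereal r" "ereal r < a"
    using ereal_dense2 by blast
  then have "\<forall>\<^sub>F n in sequentially. AE x in lebesgue_on \<Omega>. norm (w n x) \<le> r"
    using small by simp
  then show "\<forall>\<^sub>F n in sequentially. Linf_norm \<Omega> (w n) < a"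
    using Linf_norm_leI[OF meas] r by (auto elim!: eventually_mono intro: le_less_trans)
qed

text \<open>After cutting \<open>z\<close> off at its essential bound, rounding each component down to a multiple of
  \<open>1/(n+1)\<close> leaves finitely many values and an error of at most \<open>1/(n+1)\<close> per component.\<close>

lemma Linf_simple_approximation:
  fixes z :: "real ^ 'd \<Rightarrow> real ^ 'd"
  assumes nonnull: "emeasure (lebesgue_on \<Omega>) \<Omega> \<noteq> 0" and z: "z \<in> Linf_space \<Omega>"
  obtains s where "\<And>n. simple_function (lebesgue_on \<Omega>) (s n)"
    "(\<lambda>n. Linf_norm \<Omega> (\<lambda>x. s n x - z x)) \<longlonglongrightarrow> 0"
proof -
  obtain C where C: "0 \<le> C" "AE x in lebesgue_on \<Omega>. norm (z x) \<le> C"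
    using z by (rule Linf_spaceE)
  \<comment> \<open>Rounding down to the grid of mesh \<open>1/(n+1)\<close>; cut-off values are sent to \<open>0\<close>.\<close>
  define q where "q n r = real_of_int \<lfloor>real (Suc n) * (if \<bar>r\<bar> \<le> C then r else 0)\<rfloor> / real (Suc n)"
    for n and r :: real
  define s where "s n x = (\<chi> i. q n (z x $ i))" for n x
  have zm: "z \<in> borel_measurable (lebesgue_on \<Omega>)"
    using z by (rule Linf_space_measurable)
  have qm: "q n \<in> borel_measurable borel" for n
    unfolding q_def by measurable
  have s_meas: "s n \<in> borel_measurable (lebesgue_on \<Omega>)" for n
  proof -
    have "(\<lambda>x. z x \<bullet> axis i 1) \<in> borel_measurable (lebesgue_on \<Omega>)" for i
      using zm by (rule borel_measurable_inner) simp
    then have "(\<lambda>x. q n (z x $ i)) \<in> borel_measurable (lebesgue_on \<Omega>)" for i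
      by (simp add: inner_axis measurable_compose[OF _ qm])
    then show ?thesis
      by (subst borel_measurable_euclidean_space) (auto simp: s_def Basis_vec_def inner_axis)
  qed
  have fin: "finite (range (q n))" for n
  proof (rule finite_subset)
    let ?N = "real (Suc n) * C"
    show "range (q n) \<subseteq> (\<lambda>k. real_of_int k / real (Suc n)) ` {\<lfloor>- ?N\<rfloor>..\<lfloor>?N\<rfloor>}"
    proof (rule image_subsetI)
      fix r :: real
      let ?r = "if \<bar>r\<bar> \<le> C then r else 0"
      have "- C \<le> ?r" "?r \<le> C" using C(1) by auto
      then have "real (Suc n) * - C \<le> real (Suc n) * ?r" "real (Suc n) * ?r \<le> ?N"
        by (intro mult_left_mono; simp)+
      then have "\<lfloor>real (Suc n) * ?r\<rfloor> \<in> {\<lfloor>- ?N\<rfloor>..\<lfloor>?N\<rfloor>}"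
        unfolding atLeastAtMost_iff by (intro conjI floor_mono) simp_all
      then show "q n r \<in> (\<lambda>k. real_of_int k / real (Suc n)) ` {\<lfloor>- ?N\<rfloor>..\<lfloor>?N\<rfloor>}"
        unfolding q_def by blast
    qed
  qed simp
  have s_simple: "simple_function (lebesgue_on \<Omega>) (s n)" for n
  proof (rule simple_function_borel_measurable[OF s_meas])
    have "s n ` space (lebesgue_on \<Omega>) \<subseteq> vec_lambda ` (PiE UNIV (\<lambda>_. range (q n)))"
      by (auto simp: s_def)
    then show "finite (s n ` space (lebesgue_on \<Omega>))"
      by (rule finite_subset) (intro finite_imageI finite_PiE fin finite)
  qed
  have q_close: "\<bar>q n r - r\<bar> \<le> 1 / real (Suc n)" if "\<bar>r\<bar> \<le> C" for n r
  proof -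
    have "\<bar>real_of_int \<lfloor>real (Suc n) * r\<rfloor> - real (Suc n) * r\<bar> \<le> 1"
      by linarith
    then have "\<bar>(real_of_int \<lfloor>real (Suc n) * r\<rfloor> - real (Suc n) * r) / real (Suc n)\<bar> \<le> 1 / real (Suc n)"
      unfolding abs_divide abs_of_nat by (rule divide_right_mono) simp
    then show ?thesis
      using that by (simp add: q_def diff_divide_distrib)
  qed
  have close: "AE x in lebesgue_on \<Omega>. norm (s n x - z x) \<le> real CARD('d) * (1 / real (Suc n))" for n
    using C(2)
  proof eventually_elim
    case (elim x)
    have "norm (s n x - z x) \<le> (\<Sum>i\<in>UNIV. \<bar>(s n x - z x) $ i\<bar>)"
      by (rule norm_le_l1_cart)
    also have "\<dots> \<le> (\<Sum>i\<in>(UNIV :: 'd set). 1 / real (Suc n))"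
    proof (rule sum_mono)
      fix i
      have "\<bar>z x $ i\<bar> \<le> C" using elim component_le_norm_cart order_trans by blast
      then show "\<bar>(s n x - z x) $ i\<bar> \<le> 1 / real (Suc n)"
        using q_close by (simp add: s_def)
    qed
    finally show ?case by simp
  qed
  have lim: "(\<lambda>n. real CARD('d) * (1 / real (Suc n))) \<longlonglongrightarrow> real CARD('d) * 0"
    by (intro tendsto_mult tendsto_const LIMSEQ_Suc lim_1_over_n)
  have "(\<lambda>n. Linf_norm \<Omega> (\<lambda>x. s n x - z x)) \<longlonglongrightarrow> 0"
  proof (rule Linf_norm_tendsto_0I[OF nonnull])
    show "(\<lambda>x. s n x - z x) \<in> borel_measurable (lebesgue_on \<Omega>)" for n
      using s_meas zm by (rule borel_measurable_diff)
    fix \<epsilon> :: real assume "\<epsilon> > 0"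
    then have "\<forall>\<^sub>F n in sequentially. real CARD('d) * (1 / real (Suc n)) < \<epsilon>"
      using order_tendstoD(2)[OF lim] by simp
    then show "\<forall>\<^sub>F n in sequentially. AE x in lebesgue_on \<Omega>. norm (s n x - z x) \<le> \<epsilon>"
    proof eventually_elim
      case (elim n)
      with close[of n] show ?case by (auto elim!: eventually_mono)
    qed
  qed
  with s_simple show ?thesis by (rule that)
qed

section \<open>Integration against finitely additive measures\<close>

lemma ba_additive:
  "\<nu> \<in> ba \<Omega> \<Longrightarrow> A \<in> sets (lebesgue_on \<Omega>) \<Longrightarrow> B \<in> sets (lebesgue_on \<Omega>) \<Longrightarrow> A \<inter> B = {} \<Longrightarrow>
     \<nu> (A \<union> B) = \<nu> A + \<nu> B"
  by (simp add: ba_def)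

lemma ba_null: "\<nu> \<in> ba \<Omega> \<Longrightarrow> A \<in> null_sets (lebesgue_on \<Omega>) \<Longrightarrow> \<nu> A = 0"
  by (simp add: ba_def)

lemma ba_empty: "\<nu> \<in> ba \<Omega> \<Longrightarrow> \<nu> {} = 0"
  by (auto intro: ba_null)

lemma ba_finite_additive:
  assumes "\<nu> \<in> ba \<Omega>" "finite K" "\<And>k. k \<in> K \<Longrightarrow> B k \<in> sets (lebesgue_on \<Omega>)" "disjoint_family_on B K"
  shows "\<nu> (\<Union>k\<in>K. B k) = (\<Sum>k\<in>K. \<nu> (B k))"
  using assms(2-4)
proof (induction K rule: finite_induct)
  case empty
  then show ?case using assms(1) by (simp add: ba_empty)
next
  case (insert k K)
  have "B k \<inter> (\<Union>k\<in>K. B k) = {}"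
    using insert by (auto simp: disjoint_family_on_def)
  moreover have "disjoint_family_on B K"
    using insert by (auto simp: disjoint_family_on_def)
  ultimately show ?case
    using insert ba_additive[OF assms(1), of "B k" "\<Union>k\<in>K. B k"]
    by (simp add: sets.finite_UN)
qed

text \<open>A finite partition becomes a sequence by appending empty sets, whose contribution is \<open>norm (\<nu> {}) = 0\<close>.\<close>

lemma sum_norm_le_total_variation:
  assumes "\<nu> {} = 0" "finite K" "\<And>k. k \<in> K \<Longrightarrow> B k \<in> sets (lebesgue_on \<Omega>)"
    "disjoint_family_on B K" "(\<Union>k\<in>K. B k) = S"
  shows "(\<Sum>k\<in>K. ennreal (norm (\<nu> (B k)))) \<le> total_variation \<Omega> \<nu> S"
proof -
  obtain h where h: "bij_betw h {0..<card K} K"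
    using ex_bij_betw_nat_finite[OF assms(2)] by blast
  define A where "A i = (if i < card K then B (h i) else {})" for i
  have hK: "h i \<in> K" if "i < card K" for i
    using h that by (auto simp: bij_betw_def)
  have "(\<Sum>k\<in>K. ennreal (norm (\<nu> (B k)))) = (\<Sum>i\<in>{0..<card K}. ennreal (norm (\<nu> (B (h i)))))"
    by (rule sum.reindex_bij_betw[OF h, symmetric])
  also have "\<dots> = (\<Sum>i\<in>{0..<card K}. ennreal (norm (\<nu> (A i))))"
    by (simp add: A_def)
  also have "\<dots> = (\<Sum>i. ennreal (norm (\<nu> (A i))))"
    by (rule suminf_finite[symmetric]) (auto simp: A_def assms(1))
  also have "\<dots> \<le> total_variation \<Omega> \<nu> S"
    unfolding total_variation_def
  proof (rule SUP_upper, safe)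
    show "A i \<in> sets (lebesgue_on \<Omega>)" for i
      using assms(3) hK by (auto simp: A_def)
    show "disjoint_family A"
      unfolding disjoint_family_on_def
    proof (intro ballI impI)
      fix i j :: nat assume "i \<noteq> j"
      then show "A i \<inter> A j = {}"
        using hK assms(4) bij_betw_imp_inj_on[OF h]
        by (auto simp: A_def disjoint_family_on_def inj_on_eq_iff)
    qed
    have img: "h ` {0..<card K} = K" using h by (simp add: bij_betw_def)
    show "x \<in> S" if "x \<in> A i" for x i
      using that hK assms(5) by (auto simp: A_def split: if_splits)
    show "x \<in> (\<Union>i. A i)" if "x \<in> S" for x
    proof -
      obtain k where "k \<in> K" "x \<in> B k" using \<open>x \<in> S\<close> assms(5) by auto
      moreover then obtain i where "i < card K" "h i = k" using img by force
      ultimately show ?thesis by (auto simp: A_def)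
    qed
  qed
  finally show ?thesis .
qed

text \<open>The partition of \<open>S\<close> into \<open>A\<close> and \<open>S - A\<close> already bounds \<open>norm (\<nu> A)\<close>.\<close>

lemma total_variation_0_imp_vanishes:
  assumes "\<nu> {} = 0" "total_variation \<Omega> \<nu> S = 0" "S \<in> sets (lebesgue_on \<Omega>)"
    "A \<in> sets (lebesgue_on \<Omega>)" "A \<subseteq> S"
  shows "\<nu> A = 0"
proof -
  have "(\<Sum>b\<in>UNIV. ennreal (norm (\<nu> (if b then A else S - A)))) \<le> total_variation \<Omega> \<nu> S"
    by (rule sum_norm_le_total_variation) (use assms in \<open>auto simp: disjoint_family_on_def UNIV_bool\<close>)
  with assms(2) show ?thesis by (simp add: UNIV_bool)
qed

text \<open>By finite additivity, the integral of a simple field may be computed on the level sets of any finer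
  simple function \<open>u\<close>. Applied to the pair of two simple fields, it expresses their integrals and
  that of their difference over one common partition.\<close>

lemma simple_ba_integral_refine:
  assumes \<nu>: "\<nu> \<in> ba \<Omega>" and u: "simple_function (lebesgue_on \<Omega>) u"
    and s: "\<And>x. x \<in> \<Omega> \<Longrightarrow> s x = h (u x)"
  shows "simple_ba_integral \<Omega> \<nu> s = (\<Sum>p\<in>u ` \<Omega>. h p \<bullet> \<nu> (u -` {p} \<inter> \<Omega>))"
proof -
  have fin: "finite (u ` \<Omega>)" and meas: "p \<in> u ` \<Omega> \<Longrightarrow> u -` {p} \<inter> \<Omega> \<in> sets (lebesgue_on \<Omega>)" for p
    using u by (auto simp: simple_function_def)
  have img: "s ` \<Omega> = h ` u ` \<Omega>"
    using s by (auto simp: image_iff)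
  have "(\<Sum>p\<in>u ` \<Omega>. h p \<bullet> \<nu> (u -` {p} \<inter> \<Omega>))
      = (\<Sum>c\<in>h ` u ` \<Omega>. \<Sum>p\<in>{p \<in> u ` \<Omega>. h p = c}. h p \<bullet> \<nu> (u -` {p} \<inter> \<Omega>))"
    using fin by (rule sum.image_gen)
  also have "\<dots> = (\<Sum>c\<in>h ` u ` \<Omega>. c \<bullet> \<nu> (s -` {c} \<inter> \<Omega>))"
  proof (rule sum.cong[OF refl])
    fix c
    have "s -` {c} \<inter> \<Omega> = (\<Union>p\<in>{p \<in> u ` \<Omega>. h p = c}. u -` {p} \<inter> \<Omega>)"
      using s by auto
    also have "\<nu> \<dots> = (\<Sum>p\<in>{p \<in> u ` \<Omega>. h p = c}. \<nu> (u -` {p} \<inter> \<Omega>))"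
      using fin meas by (intro ba_finite_additive[OF \<nu>]) (auto simp: disjoint_family_on_def)
    finally show "(\<Sum>p\<in>{p \<in> u ` \<Omega>. h p = c}. h p \<bullet> \<nu> (u -` {p} \<inter> \<Omega>)) = c \<bullet> \<nu> (s -` {c} \<inter> \<Omega>)"
      by (simp add: inner_sum_right)
  qed
  finally show ?thesis
    by (simp add: simple_ba_integral_def img)
qed

lemma simple_ba_integral_diff:
  assumes "\<nu> \<in> ba \<Omega>" "simple_function (lebesgue_on \<Omega>) s" "simple_function (lebesgue_on \<Omega>) t"
  shows "simple_ba_integral \<Omega> \<nu> (\<lambda>x. s x - t x)
           = simple_ba_integral \<Omega> \<nu> s - simple_ba_integral \<Omega> \<nu> t"
proof -
  let ?u = "\<lambda>x. (s x, t x)"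
  have u: "simple_function (lebesgue_on \<Omega>) ?u"
    using assms(2,3) by (rule simple_function_Pair)
  show ?thesis
    using simple_ba_integral_refine[OF assms(1) u, of s fst]
      simple_ba_integral_refine[OF assms(1) u, of t snd]
      simple_ba_integral_refine[OF assms(1) u, of "\<lambda>x. s x - t x" "\<lambda>p. fst p - snd p"]
    by (simp add: inner_diff_left sum_subtractf)
qed

text \<open>Values \<open>c\<close> with \<open>norm c > C\<close> are taken on null sets only, and \<open>\<nu>\<close> vanishes there; this is where
  absolute continuity of \<open>\<nu>\<close> enters.\<close>

lemma simple_ba_integral_bound:
  assumes \<nu>: "\<nu> \<in> ba \<Omega>" and s: "simple_function (lebesgue_on \<Omega>) s"
    and C: "0 \<le> C" "AE x in lebesgue_on \<Omega>. norm (s x) \<le> C"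
  shows "\<bar>simple_ba_integral \<Omega> \<nu> s\<bar> \<le> C * enn2real (total_variation \<Omega> \<nu> \<Omega>)"
proof -
  let ?A = "\<lambda>c. s -` {c} \<inter> \<Omega>"
  have fin: "finite (s ` \<Omega>)" and meas: "c \<in> s ` \<Omega> \<Longrightarrow> ?A c \<in> sets (lebesgue_on \<Omega>)" for c
    using s by (auto simp: simple_function_def)
  have term_bound: "\<bar>c \<bullet> \<nu> (?A c)\<bar> \<le> C * norm (\<nu> (?A c))" if c: "c \<in> s ` \<Omega>" for c
  proof (cases "norm c \<le> C")
    case True
    then show ?thesis
      using Cauchy_Schwarz_ineq2[of c "\<nu> (?A c)"] mult_right_mono[OF True, of "norm (\<nu> (?A c))"]
      by simp
  next
    case False
    have "AE x in lebesgue_on \<Omega>. x \<notin> ?A c"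
      using C(2) by eventually_elim (use False in auto)
    then have "?A c \<in> null_sets (lebesgue_on \<Omega>)"
      using meas[OF c] by (simp add: AE_iff_null_sets)
    then show ?thesis by (simp add: ba_null[OF \<nu>])
  qed
  have "(\<Sum>c\<in>s ` \<Omega>. ennreal (norm (\<nu> (?A c)))) \<le> total_variation \<Omega> \<nu> \<Omega>"
    using fin meas by (intro sum_norm_le_total_variation ba_empty[OF \<nu>])
       (auto simp: disjoint_family_on_def)
  then have "ennreal (\<Sum>c\<in>s ` \<Omega>. norm (\<nu> (?A c))) \<le> total_variation \<Omega> \<nu> \<Omega>"
    by (subst sum_ennreal[symmetric]) auto
  moreover have "total_variation \<Omega> \<nu> \<Omega> < \<infinity>"
    using \<nu> by (simp add: ba_def)
  ultimately have "(\<Sum>c\<in>s ` \<Omega>. norm (\<nu> (?A c))) \<le> enn2real (total_variation \<Omega> \<nu> \<Omega>)"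
    using enn2real_mono[of "ennreal (\<Sum>c\<in>s ` \<Omega>. norm (\<nu> (?A c)))" "total_variation \<Omega> \<nu> \<Omega>"]
    by (simp add: sum_nonneg less_top)
  then have "C * (\<Sum>c\<in>s ` \<Omega>. norm (\<nu> (?A c))) \<le> C * enn2real (total_variation \<Omega> \<nu> \<Omega>)"
    using C(1) by (rule mult_left_mono)
  moreover have "\<bar>simple_ba_integral \<Omega> \<nu> s\<bar> \<le> (\<Sum>c\<in>s ` \<Omega>. C * norm (\<nu> (?A c)))"
    unfolding simple_ba_integral_def
    by (rule order_trans[OF sum_abs sum_mono]) (rule term_bound)
  ultimately show ?thesis
    by (simp add: sum_distrib_left)
qed

lemma simple_ba_integral_close:
  assumes \<nu>: "\<nu> \<in> ba \<Omega>"
    and "simple_function (lebesgue_on \<Omega>) s" "simple_function (lebesgue_on \<Omega>) t"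
    and "0 \<le> \<epsilon>" "AE x in lebesgue_on \<Omega>. norm (s x - z x) \<le> \<epsilon>"
    and "AE x in lebesgue_on \<Omega>. norm (t x - z x) \<le> \<epsilon>"
  shows "\<bar>simple_ba_integral \<Omega> \<nu> s - simple_ba_integral \<Omega> \<nu> t\<bar>
           \<le> 2 * \<epsilon> * enn2real (total_variation \<Omega> \<nu> \<Omega>)"
proof -
  have "AE x in lebesgue_on \<Omega>. norm (s x - t x) \<le> 2 * \<epsilon>"
    using assms(5,6)
  proof eventually_elim
    case (elim x)
    then show ?case
      using norm_triangle_ineq4[of "s x - z x" "t x - z x"] by simp
  qed
  then show ?thesis
    using simple_ba_integral_bound[OF \<nu> simple_function_diff[OF assms(2,3)], of "2 * \<epsilon>"]
      simple_ba_integral_diff[OF \<nu> assms(2,3)] \<open>0 \<le> \<epsilon>\<close>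
    by (simp add: fun_diff_def)
qed

text \<open>Two approximating sequences are eventually within \<open>2\<epsilon>\<close> of each other, so their integrals differ by
  at most \<open>2\<epsilon>\<close> times the total variation.\<close>

lemma has_ba_integral_unique:
  assumes \<nu>: "\<nu> \<in> ba \<Omega>" and "has_ba_integral \<Omega> \<nu> z J" "has_ba_integral \<Omega> \<nu> z J'"
  shows "J = J'"
proof -
  obtain s t where s: "\<And>n. simple_function (lebesgue_on \<Omega>) (s n)"
      "(\<lambda>n. Linf_norm \<Omega> (\<lambda>x. s n x - z x)) \<longlonglongrightarrow> 0" "(\<lambda>n. simple_ba_integral \<Omega> \<nu> (s n)) \<longlonglongrightarrow> J"
    and t: "\<And>n. simple_function (lebesgue_on \<Omega>) (t n)"
      "(\<lambda>n. Linf_norm \<Omega> (\<lambda>x. t n x - z x)) \<longlonglongrightarrow> 0" "(\<lambda>n. simple_ba_integral \<Omega> \<nu> (t n)) \<longlonglongrightarrow> J'"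
    using assms(2,3) unfolding has_ba_integral_def by blast
  let ?T = "enn2real (total_variation \<Omega> \<nu> \<Omega>)"
  have "\<bar>J - J'\<bar> \<le> 2 * \<epsilon> * ?T" if "\<epsilon> > 0" for \<epsilon>
  proof -
    have "\<forall>\<^sub>F n in sequentially. AE x in lebesgue_on \<Omega>. norm (s n x - z x) \<le> \<epsilon>"
      "\<forall>\<^sub>F n in sequentially. AE x in lebesgue_on \<Omega>. norm (t n x - z x) \<le> \<epsilon>"
      using s(2) t(2) that by (auto intro: Linf_norm_tendsto_0D)
    then have "\<forall>\<^sub>F n in sequentially. \<bar>simple_ba_integral \<Omega> \<nu> (s n) - simple_ba_integral \<Omega> \<nu> (t n)\<bar> \<le> 2 * \<epsilon> * ?T"
      by eventually_elim (use that s(1) t(1) in \<open>auto intro!: simple_ba_integral_close[OF \<nu>]\<close>)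
    moreover have "(\<lambda>n. \<bar>simple_ba_integral \<Omega> \<nu> (s n) - simple_ba_integral \<Omega> \<nu> (t n)\<bar>) \<longlonglongrightarrow> \<bar>J - J'\<bar>"
      using s(3) t(3) by (intro tendsto_intros)
    ultimately show ?thesis
      by (rule tendsto_upperbound[OF _ _ trivial_limit_sequentially, rotated])
  qed
  moreover have "((\<lambda>\<epsilon>. 2 * \<epsilon> * ?T) \<longlongrightarrow> 2 * 0 * ?T) (at_right 0)"
    by (intro tendsto_intros)
  ultimately have "\<bar>J - J'\<bar> \<le> 2 * 0 * ?T"
    by (intro tendsto_lowerbound[of "\<lambda>\<epsilon>. 2 * \<epsilon> * ?T" _ "at_right 0"])
       (auto simp: eventually_at_filter)
  then show ?thesis by simp
qed

text \<open>The same estimate makes the integrals of an approximating sequence a Cauchy sequence.\<close>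

lemma has_ba_integral_exists:
  assumes nonnull: "emeasure (lebesgue_on \<Omega>) \<Omega> \<noteq> 0" and \<nu>: "\<nu> \<in> ba \<Omega>" and z: "z \<in> Linf_space \<Omega>"
  obtains J where "has_ba_integral \<Omega> \<nu> z J"
proof -
  obtain s where s: "\<And>n. simple_function (lebesgue_on \<Omega>) (s n)"
      "(\<lambda>n. Linf_norm \<Omega> (\<lambda>x. s n x - z x)) \<longlonglongrightarrow> 0"
    using Linf_simple_approximation[OF nonnull z] by blast
  let ?T = "enn2real (total_variation \<Omega> \<nu> \<Omega>)"
  have "Cauchy (\<lambda>n. simple_ba_integral \<Omega> \<nu> (s n))"
  proof (rule metric_CauchyI)
    fix e :: real assume "e > 0"
    \<comment> \<open>Adding \<open>1\<close> avoids division by zero when the total variation vanishes.\<close>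
    define \<epsilon> where "\<epsilon> = e / (2 * (?T + 1))"
    have "?T \<ge> 0" by simp
    then have \<epsilon>: "\<epsilon> > 0" "2 * \<epsilon> * ?T < e"
      using \<open>e > 0\<close> by (simp_all add: \<epsilon>_def pos_divide_less_eq add_nonneg_pos)
    then have "\<forall>\<^sub>F n in sequentially. AE x in lebesgue_on \<Omega>. norm (s n x - z x) \<le> \<epsilon>"
      using s(2) by (auto intro: Linf_norm_tendsto_0D)
    then obtain N where "\<And>n. n \<ge> N \<Longrightarrow> AE x in lebesgue_on \<Omega>. norm (s n x - z x) \<le> \<epsilon>"
      by (auto simp: eventually_sequentially)
    then have "\<bar>simple_ba_integral \<Omega> \<nu> (s m) - simple_ba_integral \<Omega> \<nu> (s n)\<bar> \<le> 2 * \<epsilon> * ?T"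
      if "m \<ge> N" "n \<ge> N" for m n
      using that \<epsilon>(1) s(1) by (intro simple_ba_integral_close[OF \<nu>, where z = z]) auto
    then show "\<exists>N. \<forall>m\<ge>N. \<forall>n\<ge>N. dist (simple_ba_integral \<Omega> \<nu> (s m)) (simple_ba_integral \<Omega> \<nu> (s n)) < e"
      using \<epsilon>(2) unfolding dist_real_def by (meson le_less_trans)
  qed
  then obtain J where "(\<lambda>n. simple_ba_integral \<Omega> \<nu> (s n)) \<longlonglongrightarrow> J"
    using Cauchy_convergent convergent_def by blast
  with s show ?thesis
    by (intro that[of J]) (auto simp: has_ba_integral_def)
qed

lemma ba_pairing_eqI:
  assumes "\<nu> \<in> ba \<Omega>" "has_ba_integral \<Omega> \<nu> z J"
  shows "ba_pairing \<Omega> \<nu> z = J"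
  unfolding ba_pairing_def using assms(2) by (rule the_equality) (rule has_ba_integral_unique[OF assms(1) _ assms(2)])

lemma has_ba_integral_pairing:
  assumes "emeasure (lebesgue_on \<Omega>) \<Omega> \<noteq> 0" "\<nu> \<in> ba \<Omega>" "z \<in> Linf_space \<Omega>"
  shows "has_ba_integral \<Omega> \<nu> z (ba_pairing \<Omega> \<nu> z)"
  using has_ba_integral_exists[OF assms] ba_pairing_eqI[OF assms(2)] by metis

lemma ba_pairing_diff:
  assumes nonnull: "emeasure (lebesgue_on \<Omega>) \<Omega> \<noteq> 0" and \<nu>: "\<nu> \<in> ba \<Omega>"
    and z: "z \<in> Linf_space \<Omega>" and w: "w \<in> Linf_space \<Omega>"
  shows "ba_pairing \<Omega> \<nu> (\<lambda>x. z x - w x) = ba_pairing \<Omega> \<nu> z - ba_pairing \<Omega> \<nu> w"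
proof -
  obtain s t where s: "\<And>n. simple_function (lebesgue_on \<Omega>) (s n)"
      "(\<lambda>n. Linf_norm \<Omega> (\<lambda>x. s n x - z x)) \<longlonglongrightarrow> 0"
      "(\<lambda>n. simple_ba_integral \<Omega> \<nu> (s n)) \<longlonglongrightarrow> ba_pairing \<Omega> \<nu> z"
    and t: "\<And>n. simple_function (lebesgue_on \<Omega>) (t n)"
      "(\<lambda>n. Linf_norm \<Omega> (\<lambda>x. t n x - w x)) \<longlonglongrightarrow> 0"
      "(\<lambda>n. simple_ba_integral \<Omega> \<nu> (t n)) \<longlonglongrightarrow> ba_pairing \<Omega> \<nu> w"
    using has_ba_integral_pairing[OF nonnull \<nu> z] has_ba_integral_pairing[OF nonnull \<nu> w]
    unfolding has_ba_integral_def by blast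
  have meas: "(\<lambda>x. s n x - t n x - (z x - w x)) \<in> borel_measurable (lebesgue_on \<Omega>)" for n
    using s(1) t(1) z w
    by (auto intro!: borel_measurable_diff intro: borel_measurable_simple_function Linf_space_measurable)
  have "(\<lambda>n. Linf_norm \<Omega> (\<lambda>x. s n x - t n x - (z x - w x))) \<longlonglongrightarrow> 0"
  proof (rule Linf_norm_tendsto_0I[OF nonnull meas])
    fix \<epsilon> :: real assume "\<epsilon> > 0"
    then have "\<epsilon> / 2 > 0" by simp
    then have "\<forall>\<^sub>F n in sequentially. AE x in lebesgue_on \<Omega>. norm (s n x - z x) \<le> \<epsilon> / 2"
      "\<forall>\<^sub>F n in sequentially. AE x in lebesgue_on \<Omega>. norm (t n x - w x) \<le> \<epsilon> / 2"
      using Linf_norm_tendsto_0D[OF s(2)] Linf_norm_tendsto_0D[OF t(2)] by blast+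
    then show "\<forall>\<^sub>F n in sequentially. AE x in lebesgue_on \<Omega>. norm (s n x - t n x - (z x - w x)) \<le> \<epsilon>"
    proof eventually_elim
      case (elim n)
      then show ?case
      proof eventually_elim
        case (elim x)
        then show ?case
          using norm_triangle_ineq4[of "s n x - z x" "t n x - w x"] by (simp add: algebra_simps)
      qed
    qed
  qed
  moreover have "(\<lambda>n. simple_ba_integral \<Omega> \<nu> (\<lambda>x. s n x - t n x)) \<longlonglongrightarrow> ba_pairing \<Omega> \<nu> z - ba_pairing \<Omega> \<nu> w"
    using s(3) t(3) by (simp add: simple_ba_integral_diff[OF \<nu> s(1) t(1)] tendsto_diff)
  ultimately have "has_ba_integral \<Omega> \<nu> (\<lambda>x. z x - w x) (ba_pairing \<Omega> \<nu> z - ba_pairing \<Omega> \<nu> w)"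
    unfolding has_ba_integral_def using s(1) t(1) simple_function_diff
    by (intro exI[of _ "\<lambda>n x. s n x - t n x"]) (auto simp: fun_diff_def)
  then show ?thesis
    by (rule ba_pairing_eqI[OF \<nu>])
qed

lemma ba_pairing_AE_cong:
  assumes nonnull: "emeasure (lebesgue_on \<Omega>) \<Omega> \<noteq> 0" and \<nu>: "\<nu> \<in> ba \<Omega>"
    and z: "z \<in> Linf_space \<Omega>" and w: "w \<in> Linf_space \<Omega>" and eq: "AE x in lebesgue_on \<Omega>. z x = w x"
  shows "ba_pairing \<Omega> \<nu> z = ba_pairing \<Omega> \<nu> w"
proof -
  have "has_ba_integral \<Omega> \<nu> w (ba_pairing \<Omega> \<nu> z)"
  proof -
    obtain s where s: "\<And>n. simple_function (lebesgue_on \<Omega>) (s n)"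
        "(\<lambda>n. Linf_norm \<Omega> (\<lambda>x. s n x - z x)) \<longlonglongrightarrow> 0"
        "(\<lambda>n. simple_ba_integral \<Omega> \<nu> (s n)) \<longlonglongrightarrow> ba_pairing \<Omega> \<nu> z"
      using has_ba_integral_pairing[OF nonnull \<nu> z] unfolding has_ba_integral_def by blast
    have "Linf_norm \<Omega> (\<lambda>x. s n x - z x) = Linf_norm \<Omega> (\<lambda>x. s n x - w x)" for n
      unfolding Linf_norm_def
    proof (rule esssup_AE_cong)
      have "(\<lambda>x. s n x - z x) \<in> borel_measurable (lebesgue_on \<Omega>)"
        "(\<lambda>x. s n x - w x) \<in> borel_measurable (lebesgue_on \<Omega>)"
        using s(1) z w by (auto intro: borel_measurable_diff borel_measurable_simple_function Linf_space_measurable)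
      then show "(\<lambda>x. ereal (norm (s n x - z x))) \<in> borel_measurable (lebesgue_on \<Omega>)"
        "(\<lambda>x. ereal (norm (s n x - w x))) \<in> borel_measurable (lebesgue_on \<Omega>)"
        by measurable
      show "AE x in lebesgue_on \<Omega>. ereal (norm (s n x - z x)) = ereal (norm (s n x - w x))"
        using eq by eventually_elim simp
    qed
    with s show ?thesis unfolding has_ba_integral_def by auto
  qed
  then show ?thesis
    using ba_pairing_eqI[OF \<nu>] by simp
qed

lemma simple_ba_integral_cong:
  assumes "simple_function (lebesgue_on \<Omega>) s" "\<And>A. A \<in> sets (lebesgue_on \<Omega>) \<Longrightarrow> \<nu> A = \<nu>' A"
  shows "simple_ba_integral \<Omega> \<nu> s = simple_ba_integral \<Omega> \<nu>' s"
  unfolding simple_ba_integral_def using assms by (intro sum.cong) (auto simp: simple_function_def)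

lemma ba_pairing_cong:
  assumes "\<And>A. A \<in> sets (lebesgue_on \<Omega>) \<Longrightarrow> \<nu> A = \<nu>' A"
  shows "ba_pairing \<Omega> \<nu> = ba_pairing \<Omega> \<nu>'"
proof -
  have "has_ba_integral \<Omega> \<nu> z J \<longleftrightarrow> has_ba_integral \<Omega> \<nu>' z J" for z J
    unfolding has_ba_integral_def
    by (rule iff_exI) (use simple_ba_integral_cong[OF _ assms] in \<open>auto cong: conj_cong\<close>)
  then show ?thesis by (auto simp: ba_pairing_def fun_eq_iff)
qed

text \<open>Here equality holds on all sets, not only on measurable ones, because \<open>scale_ba\<close> reaches \<open>\<nu>\<close> only
  through level sets of simple functions.\<close>

lemma scale_ba_cong:
  assumes "\<And>A. A \<in> sets (lebesgue_on \<Omega>) \<Longrightarrow> \<nu> A = \<nu>' A"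
  shows "scale_ba \<Omega> \<zeta> \<nu> = scale_ba \<Omega> \<zeta> \<nu>'"
  by (simp add: fun_eq_iff scale_ba_def ba_pairing_cong[OF assms])

section \<open>Lebesgue decomposition\<close>

text \<open>Hoelder's inequality for exponents \<open>1\<close> and \<open>\<infinity>\<close>.\<close>

lemma
  fixes y w :: "'a \<Rightarrow> 'b::euclidean_space"
  assumes y: "integrable M y" and w: "w \<in> borel_measurable M" "AE x in M. norm (w x) \<le> C"
  shows integrable_bounded_inner: "integrable M (\<lambda>x. w x \<bullet> y x :: real)"
    and integral_bounded_inner_le: "\<bar>LINT x|M. w x \<bullet> y x\<bar> \<le> C * (LINT x|M. norm (y x))"
proof -
  have le: "AE x in M. norm (w x \<bullet> y x) \<le> C * norm (y x)"
    using w(2) by eventually_elim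
      (metis Cauchy_Schwarz_ineq2 mult_right_mono norm_ge_zero order_trans real_norm_def)
  have int: "integrable M (\<lambda>x. C * norm (y x))"
    using integrable_norm[OF y] by simp
  show i: "integrable M (\<lambda>x. w x \<bullet> y x)"
    using le int w(1) borel_measurable_integrable[OF y]
    by (intro Bochner_Integration.integrable_bound[OF int]) (auto elim!: eventually_mono)
  have "\<bar>LINT x|M. w x \<bullet> y x\<bar> \<le> (LINT x|M. norm (w x \<bullet> y x))"
    by (metis integral_norm_bound real_norm_def)
  also have "\<dots> \<le> (LINT x|M. C * norm (y x))"
    using i int le by (intro integral_mono_AE integrable_norm)
  finally show "\<bar>LINT x|M. w x \<bullet> y x\<bar> \<le> C * (LINT x|M. norm (y x))"
    by simp
qed

lemma simple_function_AE_bounded: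
  assumes "simple_function M s"
  obtains C :: real where "AE x in M. norm (s x) \<le> C"
proof -
  have "bounded (s ` space M)"
    using assms by (intro finite_imp_bounded) (simp add: simple_function_def)
  then obtain C where "\<And>x. x \<in> space M \<Longrightarrow> norm (s x) \<le> C"
    by (auto simp: bounded_iff)
  then show ?thesis by (intro that[of C] AE_I2)
qed

lemma simple_ba_integral_density:
  assumes y: "integrable (lebesgue_on \<Omega>) y" and s: "simple_function (lebesgue_on \<Omega>) s"
  shows "simple_ba_integral \<Omega> (density_ba \<Omega> y) s = (LINT x|lebesgue_on \<Omega>. s x \<bullet> y x)"
proof -
  let ?A = "\<lambda>c. s -` {c} \<inter> \<Omega>"
  have fin: "finite (s ` \<Omega>)" and meas: "c \<in> s ` \<Omega> \<Longrightarrow> ?A c \<in> sets (lebesgue_on \<Omega>)" for c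
    using s by (auto simp: simple_function_def)
  have int: "integrable (lebesgue_on \<Omega>) (\<lambda>x. indicator (?A c) x *\<^sub>R y x)" if "c \<in> s ` \<Omega>" for c
    using y meas[OF that] by (intro integrable_mult_indicator)
  have "simple_ba_integral \<Omega> (density_ba \<Omega> y) s
      = (\<Sum>c\<in>s ` \<Omega>. LINT x|lebesgue_on \<Omega>. c \<bullet> (indicator (?A c) x *\<^sub>R y x))"
    unfolding simple_ba_integral_def density_ba_def
    by (intro sum.cong refl integral_inner_right[symmetric] int)
  also have "\<dots> = (LINT x|lebesgue_on \<Omega>. (\<Sum>c\<in>s ` \<Omega>. c \<bullet> (indicator (?A c) x *\<^sub>R y x)))"
    by (intro Bochner_Integration.integral_sum[symmetric] integrable_inner_right int)
  also have "\<dots> = (LINT x|lebesgue_on \<Omega>. s x \<bullet> y x)"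
  proof (rule Bochner_Integration.integral_cong[OF refl])
    fix x assume "x \<in> space (lebesgue_on \<Omega>)"
    then have x: "x \<in> \<Omega>" by simp
    have "(\<Sum>c\<in>s ` \<Omega>. c \<bullet> (indicator (?A c) x *\<^sub>R y x)) = (\<Sum>c\<in>s ` \<Omega>. if c = s x then c \<bullet> y x else 0)"
      using x by (intro sum.cong) auto
    also have "\<dots> = s x \<bullet> y x"
      using fin x by (simp add: sum.delta)
    finally show "(\<Sum>c\<in>s ` \<Omega>. c \<bullet> (indicator (?A c) x *\<^sub>R y x)) = s x \<bullet> y x" .
  qed
  finally show ?thesis .
qed

text \<open>For simple fields the splitting is finite additivity of the sum. It passes to the limit because
  \<open>s \<mapsto> \<integral> s \<bullet> y\<close> is continuous for uniform convergence almost everywhere when \<open>y\<close> is integrable.\<close>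

lemma ba_pairing_lebesgue_decomposition:
  assumes nonnull: "emeasure (lebesgue_on \<Omega>) \<Omega> \<noteq> 0" and \<nu>: "\<nu> \<in> ba \<Omega>"
    and dec: "lebesgue_decomposition \<Omega> \<nu> y \<nu>s" and z: "z \<in> Linf_space \<Omega>"
  shows "ba_pairing \<Omega> \<nu> z = (LINT x|lebesgue_on \<Omega>. z x \<bullet> y x) + ba_pairing \<Omega> \<nu>s z"
proof -
  have y: "integrable (lebesgue_on \<Omega>) y" and \<nu>s: "\<nu>s \<in> ba \<Omega>"
    and eq: "\<And>A. A \<in> sets (lebesgue_on \<Omega>) \<Longrightarrow> \<nu> A = density_ba \<Omega> y A + \<nu>s A"
    using dec by (auto simp: lebesgue_decomposition_def L1_space_def singular_ba_def)
  have zm: "z \<in> borel_measurable (lebesgue_on \<Omega>)"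
    using z by (rule Linf_space_measurable)
  obtain s where s: "\<And>n. simple_function (lebesgue_on \<Omega>) (s n)"
      "(\<lambda>n. Linf_norm \<Omega> (\<lambda>x. s n x - z x)) \<longlonglongrightarrow> 0"
      "(\<lambda>n. simple_ba_integral \<Omega> \<nu>s (s n)) \<longlonglongrightarrow> ba_pairing \<Omega> \<nu>s z"
    using has_ba_integral_pairing[OF nonnull \<nu>s z] unfolding has_ba_integral_def by blast
  have sm: "s n \<in> borel_measurable (lebesgue_on \<Omega>)" for n
    using s(1) by (rule borel_measurable_simple_function)
  have meas: "(\<lambda>x. s n x - z x) \<in> borel_measurable (lebesgue_on \<Omega>)" for n
    using sm zm by (rule borel_measurable_diff)
  have split: "simple_ba_integral \<Omega> \<nu> (s n)
      = (LINT x|lebesgue_on \<Omega>. s n x \<bullet> y x) + simple_ba_integral \<Omega> \<nu>s (s n)" for n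
  proof -
    have "simple_ba_integral \<Omega> \<nu> (s n) = simple_ba_integral \<Omega> (\<lambda>A. density_ba \<Omega> y A + \<nu>s A) (s n)"
      by (rule simple_ba_integral_cong[OF s(1)]) (rule eq)
    also have "\<dots> = simple_ba_integral \<Omega> (density_ba \<Omega> y) (s n) + simple_ba_integral \<Omega> \<nu>s (s n)"
      by (simp add: simple_ba_integral_def inner_add_right sum.distrib)
    finally show ?thesis
      by (simp add: simple_ba_integral_density[OF y s(1)])
  qed
  let ?Y = "LINT x|lebesgue_on \<Omega>. norm (y x)"
  have "(\<lambda>n. (LINT x|lebesgue_on \<Omega>. s n x \<bullet> y x) - (LINT x|lebesgue_on \<Omega>. z x \<bullet> y x)) \<longlonglongrightarrow> 0"
  proof (rule LIMSEQ_I)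
    fix e :: real assume e: "e > 0"
    define \<epsilon> where "\<epsilon> = e / (?Y + 1)"
    have "?Y \<ge> 0" by simp
    then have \<epsilon>: "\<epsilon> > 0" "\<epsilon> * ?Y < e"
      using e by (simp_all add: \<epsilon>_def pos_divide_less_eq add_nonneg_pos)
    have "\<forall>\<^sub>F n in sequentially. AE x in lebesgue_on \<Omega>. norm (s n x - z x) \<le> \<epsilon>"
      using s(2) \<epsilon>(1) by (rule Linf_norm_tendsto_0D)
    then have "\<forall>\<^sub>F n in sequentially.
        norm ((LINT x|lebesgue_on \<Omega>. s n x \<bullet> y x) - (LINT x|lebesgue_on \<Omega>. z x \<bullet> y x) - 0) < e"
    proof eventually_elim
      case (elim n)
      obtain B where "AE x in lebesgue_on \<Omega>. norm (s n x) \<le> B"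
        using simple_function_AE_bounded[OF s(1)] by blast
      moreover obtain C where "AE x in lebesgue_on \<Omega>. norm (z x) \<le> C"
        using z by (rule Linf_spaceE)
      ultimately have "integrable (lebesgue_on \<Omega>) (\<lambda>x. s n x \<bullet> y x)"
        "integrable (lebesgue_on \<Omega>) (\<lambda>x. z x \<bullet> y x)"
        using integrable_bounded_inner[OF y sm] integrable_bounded_inner[OF y zm] by blast+
      then have "(LINT x|lebesgue_on \<Omega>. s n x \<bullet> y x) - (LINT x|lebesgue_on \<Omega>. z x \<bullet> y x)
          = (LINT x|lebesgue_on \<Omega>. (s n x - z x) \<bullet> y x)"
        by (simp add: inner_diff_left)
      then show ?case
        using integral_bounded_inner_le[OF y meas elim] \<epsilon>(2) by simp
    qed
    then show "\<exists>N. \<forall>n\<ge>N.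
        norm ((LINT x|lebesgue_on \<Omega>. s n x \<bullet> y x) - (LINT x|lebesgue_on \<Omega>. z x \<bullet> y x) - 0) < e"
      by (simp add: eventually_sequentially)
  qed
  then have "(\<lambda>n. LINT x|lebesgue_on \<Omega>. s n x \<bullet> y x) \<longlonglongrightarrow> (LINT x|lebesgue_on \<Omega>. z x \<bullet> y x)"
    by (rule LIM_zero_cancel)
  with s(3) have "(\<lambda>n. simple_ba_integral \<Omega> \<nu> (s n)) \<longlonglongrightarrow>
      (LINT x|lebesgue_on \<Omega>. z x \<bullet> y x) + ba_pairing \<Omega> \<nu>s z"
    unfolding split by (rule tendsto_add[rotated])
  with s(1,2) have "has_ba_integral \<Omega> \<nu> z ((LINT x|lebesgue_on \<Omega>. z x \<bullet> y x) + ba_pairing \<Omega> \<nu>s z)"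
    unfolding has_ba_integral_def by blast
  then show ?thesis
    by (rule ba_pairing_eqI[OF \<nu>])
qed

lemma singular_baE:
  assumes "\<nu> \<in> singular_ba \<Omega>"
  obtains E :: "nat \<Rightarrow> (real ^ 'd) set" where "\<And>n. E n \<in> sets (lebesgue_on \<Omega>)" "decseq E"
    "(\<lambda>n. emeasure lebesgue (E n)) \<longlonglongrightarrow> 0"
    "\<And>n A. A \<in> sets (lebesgue_on \<Omega>) \<Longrightarrow> A \<inter> E n = {} \<Longrightarrow> \<nu> A = 0"
proof -
  obtain E where E: "range E \<subseteq> sets (lebesgue_on \<Omega>)" "decseq E"
      "(\<lambda>n. emeasure lebesgue (E n)) \<longlonglongrightarrow> 0" "\<And>n. total_variation \<Omega> \<nu> (\<Omega> - E n) = 0"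
    using assms by (auto simp: singular_ba_def)
  have top: "\<Omega> \<in> sets (lebesgue_on \<Omega>)"
    using sets.top[of "lebesgue_on \<Omega>"] by simp
  have "\<nu> A = 0" if "A \<in> sets (lebesgue_on \<Omega>)" "A \<inter> E n = {}" for A n
  proof (rule total_variation_0_imp_vanishes)
    show "\<nu> {} = 0" using assms by (auto simp: singular_ba_def intro: ba_empty)
    show "\<Omega> - E n \<in> sets (lebesgue_on \<Omega>)" using E(1) top by auto
    show "A \<subseteq> \<Omega> - E n" using that sets.sets_into_space[OF that(1)] by auto
  qed (use E that in auto)
  with E show ?thesis by (intro that[of E]) auto
qed

text \<open>Both singular parts vanish on measurable sets that avoid \<open>E n \<union> F n\<close>, where \<open>E\<close> and \<open>F\<close> carry the
  two singular parts. So the densities have equal integrals over \<open>A - (E n \<union> F n)\<close>, and by dominated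
  convergence over \<open>A\<close>, since the decreasing sets \<open>E n\<close> and \<open>F n\<close> shrink to null sets.\<close>

lemma lebesgue_decomposition_unique:
  fixes \<Omega> :: "(real ^ 'd) set"
  assumes meas: "\<Omega> \<in> lmeasurable"
    and dec: "lebesgue_decomposition \<Omega> \<nu> y \<nu>s" "lebesgue_decomposition \<Omega> \<nu> y' \<nu>s'"
  shows "AE x in lebesgue_on \<Omega>. y x = y' x"
    and "A \<in> sets (lebesgue_on \<Omega>) \<Longrightarrow> \<nu>s A = \<nu>s' A"
proof -
  let ?M = "lebesgue_on \<Omega>"
  have y: "integrable ?M y" "integrable ?M y'"
    and sing: "\<nu>s \<in> singular_ba \<Omega>" "\<nu>s' \<in> singular_ba \<Omega>"
    and eq: "\<And>A. A \<in> sets ?M \<Longrightarrow> density_ba \<Omega> y A + \<nu>s A = density_ba \<Omega> y' A + \<nu>s' A"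
    using dec by (auto simp: lebesgue_decomposition_def L1_space_def)
  obtain E where E: "\<And>n. E n \<in> sets ?M" "decseq E" "(\<lambda>n. emeasure lebesgue (E n)) \<longlonglongrightarrow> 0"
    "\<And>n A. A \<in> sets ?M \<Longrightarrow> A \<inter> E n = {} \<Longrightarrow> \<nu>s A = 0"
    using singular_baE[OF sing(1)] by blast
  obtain F where F: "\<And>n. F n \<in> sets ?M" "decseq F" "(\<lambda>n. emeasure lebesgue (F n)) \<longlonglongrightarrow> 0"
    "\<And>n A. A \<in> sets ?M \<Longrightarrow> A \<inter> F n = {} \<Longrightarrow> \<nu>s' A = 0"
    using singular_baE[OF sing(2)] by blast
  have fin: "finite_measure ?M"
    using meas by (rule finite_measure_lebesgue_on)
  have null: "(\<Inter>n. G n) \<in> null_sets ?M"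
    if G: "\<And>n. G n \<in> sets ?M" "(\<lambda>n. emeasure lebesgue (G n)) \<longlonglongrightarrow> 0" for G :: "nat \<Rightarrow> _"
  proof -
    have "(\<Inter>n. G n) \<in> sets ?M" using G(1) by auto
    moreover have "emeasure ?M (\<Inter>n. G n) \<le> 0"
    proof (rule tendsto_lowerbound[OF G(2)])
      show "\<forall>\<^sub>F n in sequentially. emeasure ?M (\<Inter>n. G n) \<le> emeasure lebesgue (G n)"
      proof (rule always_eventually, rule allI)
        fix n
        have "emeasure ?M (\<Inter>n. G n) \<le> emeasure ?M (G n)"
          using G(1) by (intro emeasure_mono) auto
        also have "\<dots> = emeasure lebesgue (G n)"
          using G(1)[of n] meas sets.sets_into_space[OF G(1)[of n]]
          by (intro emeasure_restrict_space) auto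
        finally show "emeasure ?M (\<Inter>n. G n) \<le> emeasure lebesgue (G n)" .
      qed
    qed simp
    ultimately show ?thesis by (auto simp: null_sets_def)
  qed
  \<comment> \<open>A point outside the null set \<open>\<Inter>n. G n\<close> leaves the decreasing sequence for good.\<close>
  have eventually_out: "\<forall>\<^sub>F n in sequentially. x \<notin> G n"
    if "decseq G" "x \<notin> (\<Inter>n. G n)" for G :: "nat \<Rightarrow> (real ^ 'd) set" and x
    using that unfolding eventually_sequentially decseq_def by blast
  have zero: "set_lebesgue_integral ?M A (\<lambda>x. y x - y' x) = 0" if A: "A \<in> sets ?M" for A
  proof -
    define B where "B n = A - (E n \<union> F n)" for n
    have B: "B n \<in> sets ?M" for n
      using A E(1) F(1) by (auto simp: B_def)
    have int: "integrable ?M (\<lambda>x. indicator S x *\<^sub>R y x)" "integrable ?M (\<lambda>x. indicator S x *\<^sub>R y' x)"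
      if "S \<in> sets ?M" for S
      using y that by (auto intro: integrable_mult_indicator)
    have "(LINT x|?M. indicator (B n) x *\<^sub>R (y x - y' x)) = 0" for n
    proof -
      have "\<nu>s (B n) = 0" "\<nu>s' (B n) = 0"
        using B E(4)[of "B n" n] F(4)[of "B n" n] by (auto simp: B_def)
      then have "density_ba \<Omega> y (B n) = density_ba \<Omega> y' (B n)"
        using eq[OF B, of n] by simp
      then show ?thesis
        using int[OF B] by (simp add: density_ba_def scaleR_diff_right)
    qed
    moreover have "(\<lambda>n. LINT x|?M. indicator (B n) x *\<^sub>R (y x - y' x)) \<longlonglongrightarrow>
        (LINT x|?M. indicator A x *\<^sub>R (y x - y' x))"
    proof (rule integral_dominated_convergence[where w = "\<lambda>x. norm (y x - y' x)"])
      show "(\<lambda>x. indicator A x *\<^sub>R (y x - y' x)) \<in> borel_measurable ?M"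
        "\<And>n. (\<lambda>x. indicator (B n) x *\<^sub>R (y x - y' x)) \<in> borel_measurable ?M"
        using A B y by (auto intro!: borel_measurable_scaleR borel_measurable_indicator borel_measurable_diff)
      show "integrable ?M (\<lambda>x. norm (y x - y' x))"
        using y by (intro integrable_norm Bochner_Integration.integrable_diff)
      show "AE x in ?M. norm (indicator (B n) x *\<^sub>R (y x - y' x)) \<le> norm (y x - y' x)" for n
        by (auto simp: indicator_def)
      have "AE x in ?M. x \<notin> (\<Inter>n. E n)" "AE x in ?M. x \<notin> (\<Inter>n. F n)"
        using AE_not_in[OF null[OF E(1,3)]] AE_not_in[OF null[OF F(1,3)]] by blast+
      then show "AE x in ?M. (\<lambda>n. indicator (B n) x *\<^sub>R (y x - y' x)) \<longlonglongrightarrow> indicator A x *\<^sub>R (y x - y' x)"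
      proof eventually_elim
        case (elim x)
        have "\<forall>\<^sub>F n in sequentially. indicator (B n) x *\<^sub>R (y x - y' x) = indicator A x *\<^sub>R (y x - y' x)"
          using eventually_out[OF E(2) elim(1)] eventually_out[OF F(2) elim(2)]
          by eventually_elim (auto simp: B_def indicator_def)
        then show ?case by (rule tendsto_eventually)
      qed
    qed
    ultimately show ?thesis
      by (simp add: set_lebesgue_integral_def LIMSEQ_const_iff)
  qed
  have "AE x in ?M. y x - y' x = 0"
    using y zero
    by (intro sigma_finite_measure.density_zero[OF finite_measure.axioms(1)[OF fin]]) auto
  then show ae: "AE x in ?M. y x = y' x" by simp
  have "density_ba \<Omega> y A = density_ba \<Omega> y' A" if "A \<in> sets ?M"
    unfolding density_ba_def
  proof (rule integral_cong_AE)
    show "(\<lambda>x. indicator A x *\<^sub>R y x) \<in> borel_measurable ?M"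
      "(\<lambda>x. indicator A x *\<^sub>R y' x) \<in> borel_measurable ?M"
      using y that by (auto intro!: borel_measurable_scaleR borel_measurable_indicator)
    show "AE x in ?M. indicator A x *\<^sub>R y x = indicator A x *\<^sub>R y' x"
      using ae by eventually_elim simp
  qed
  then show "A \<in> sets ?M \<Longrightarrow> \<nu>s A = \<nu>s' A"
    using eq[of A] by simp
qed

section \<open>Uniqueness and linearity of weak gradients\<close>

text \<open>The fundamental lemma of the calculus of variations. Dominated convergence along the bumps turns
  the hypothesis into vanishing integrals over all boxes whose closure lies in \<open>\<Omega>\<close>; hence \<open>H\<close>
  vanishes almost everywhere on each closed box in \<open>\<Omega>\<close>, and countably many of these cover \<open>\<Omega>\<close>.\<close>

lemma AE_0_if_test_integrals_0:
  fixes H :: "real ^ 'd \<Rightarrow> 'b::euclidean_space"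
  assumes "open \<Omega>" and H: "integrable (lebesgue_on \<Omega>) H"
    and test: "\<And>\<phi>. \<phi> \<in> test_functions \<Omega> \<Longrightarrow> (LINT x|lebesgue_on \<Omega>. \<phi> x *\<^sub>R H x) = 0"
  shows "AE x in lebesgue_on \<Omega>. H x = 0"
proof -
  have \<Omega>: "\<Omega> \<in> sets lebesgue" using \<open>open \<Omega>\<close> by (simp add: borel_open)
  have Hm: "H \<in> borel_measurable (lebesgue_on \<Omega>)" using H by (rule borel_measurable_integrable)
  have box0: "(LINT x|lebesgue_on \<Omega>. indicator (box a b) x *\<^sub>R H x) = 0" if ab: "cbox a b \<subseteq> \<Omega>" for a b
  proof -
    have bump: "box_bump a b n \<in> test_functions \<Omega>" for n
      using ab by (rule box_bump_test_function)
    then have bump_meas: "box_bump a b n \<in> borel_measurable (lebesgue_on \<Omega>)" for n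
      using \<Omega> by (metis continuous_imp_measurable_on_sets_lebesgue continuous_on_subset subset_UNIV test_functionE)
    have "(\<lambda>n. LINT x|lebesgue_on \<Omega>. box_bump a b n x *\<^sub>R H x)
        \<longlonglongrightarrow> (LINT x|lebesgue_on \<Omega>. indicator (box a b) x *\<^sub>R H x)"
    proof (rule integral_dominated_convergence[where w = "\<lambda>x. norm (H x)"])
      have "box a b \<in> sets (lebesgue_on \<Omega>)"
        using ab box_subset_cbox[of a b] \<Omega> by (subst sets_restrict_space_iff) auto
      then show "(\<lambda>x. indicator (box a b) x *\<^sub>R H x) \<in> borel_measurable (lebesgue_on \<Omega>)"
        using Hm by (intro borel_measurable_scaleR borel_measurable_indicator)
      show "(\<lambda>x. box_bump a b n x *\<^sub>R H x) \<in> borel_measurable (lebesgue_on \<Omega>)" for n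
        using bump_meas Hm by (rule borel_measurable_scaleR)
      show "integrable (lebesgue_on \<Omega>) (\<lambda>x. norm (H x))"
        using H by (rule integrable_norm)
      show "AE x in lebesgue_on \<Omega>. (\<lambda>n. box_bump a b n x *\<^sub>R H x) \<longlonglongrightarrow> indicator (box a b) x *\<^sub>R H x"
        by (intro AE_I2 tendsto_scaleR box_bump_tendsto tendsto_const)
      show "AE x in lebesgue_on \<Omega>. norm (box_bump a b n x *\<^sub>R H x) \<le> norm (H x)" for n
        using mult_left_le_one_le[OF norm_ge_zero abs_ge_zero box_bump_bounds] by (intro AE_I2) simp
    qed
    then show ?thesis
      by (simp add: test[OF bump] LIMSEQ_const_iff)
  qed
  have cell: "AE x in lebesgue. x \<in> cbox c d \<longrightarrow> H x = 0" if cd: "cbox c d \<subseteq> \<Omega>" for c d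
  proof -
    let ?h = "\<lambda>x. indicator (box c d) x *\<^sub>R indicator \<Omega> x *\<^sub>R H x"
    have "AE x in lebesgue. ?h x = 0"
    proof (rule lebesgue_AE_0_if_box_integrals_0)
      show "integrable lebesgue ?h"
        using H \<Omega> by (intro integrable_mult_indicator[of "box c d"]) (auto simp: integrable_restrict_space)
      show "?h x = 0" if "x \<notin> box c d" for x
        using that by simp
      fix a b assume sub: "box a b \<subseteq> box c d"
      have "(LINT x|lebesgue. indicator (box a b) x *\<^sub>R ?h x)
          = (LINT x|lebesgue. indicator \<Omega> x *\<^sub>R indicator (box a b) x *\<^sub>R H x)"
        using sub by (intro Bochner_Integration.integral_cong) (auto simp: indicator_def)
      also have "\<dots> = (LINT x|lebesgue_on \<Omega>. indicator (box a b) x *\<^sub>R H x)"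
        using \<Omega> by (subst integral_restrict_space) auto
      also have "\<dots> = 0"
      proof (cases "box a b = {}")
        case False
        have "cbox a b = closure (box a b)" using False by (rule closure_box[symmetric])
        also have "\<dots> \<subseteq> cbox c d"
          using sub box_subset_cbox by (intro closure_minimal closed_cbox) blast
        finally show ?thesis using cd by (intro box0) auto
      qed simp
      finally show "(LINT x|lebesgue. indicator (box a b) x *\<^sub>R ?h x) = 0" .
    qed
    \<comment> \<open>The faces of a box are null, so the conclusion extends to closed boxes, which cover \<open>\<Omega>\<close> below.\<close>
    moreover have "AE x in lebesgue. x \<notin> cbox c d - box c d"
      using negligible_frontier_interval[of c d] by (intro AE_not_in) (simp add: negligible_iff_null_sets)
    ultimately show ?thesis
      by eventually_elim (use cd in \<open>auto simp: indicator_def split: if_splits\<close>)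
  qed
  obtain \<D> where \<D>: "countable \<D>" "\<D> \<subseteq> Pow \<Omega>" "\<And>X. X \<in> \<D> \<Longrightarrow> \<exists>a b. X = cbox a b" "\<Union>\<D> = \<Omega>"
    using open_countable_Union_open_cbox[OF \<open>open \<Omega>\<close>] by metis
  have "AE x in lebesgue. \<forall>X\<in>\<D>. x \<in> X \<longrightarrow> H x = 0"
  proof (rule AE_ball_countable'[OF _ \<D>(1)])
    fix X assume "X \<in> \<D>"
    then show "AE x in lebesgue. x \<in> X \<longrightarrow> H x = 0"
      using \<D>(2,3) cell by blast
  qed
  then have "AE x in lebesgue. x \<in> \<Omega> \<longrightarrow> H x = 0"
    by eventually_elim (use \<D>(4) in blast)
  then show ?thesis
    using \<Omega> by (simp add: AE_restrict_space_iff)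
qed

lemma Linf_integrable:
  assumes "\<Omega> \<in> lmeasurable" "f \<in> Linf_space \<Omega>"
  shows "integrable (lebesgue_on \<Omega>) f"
proof -
  obtain C where "AE x in lebesgue_on \<Omega>. norm (f x) \<le> C" using assms(2) by (rule Linf_spaceE)
  then show ?thesis
    using Linf_space_measurable[OF assms(2)]
    by (rule finite_measure.integrable_const_bound[OF finite_measure_lebesgue_on[OF assms(1)]])
qed

lemma continuous_in_Linf:
  assumes "\<Omega> \<in> sets lebesgue" "bounded \<Omega>" "continuous_on UNIV f"
  shows "f \<in> Linf_space \<Omega>"
proof -
  have "compact (f ` closure \<Omega>)"
    using assms by (intro compact_continuous_image continuous_on_subset[OF assms(3)]) auto
  then obtain C where C: "\<And>x. x \<in> closure \<Omega> \<Longrightarrow> norm (f x) \<le> C"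
    using compact_imp_bounded by (force simp: bounded_iff)
  show ?thesis
  proof (rule Linf_spaceI)
    show "f \<in> borel_measurable (lebesgue_on \<Omega>)"
      using continuous_on_subset[OF assms(3)] assms(1)
      by (intro continuous_imp_measurable_on_sets_lebesgue) auto
    show "AE x in lebesgue_on \<Omega>. norm (f x) \<le> C"
      using C closure_subset by (intro AE_I2) auto
  qed
qed

lemma Linf_scaleR:
  assumes "u \<in> Linf_space \<Omega>" "f \<in> Linf_space \<Omega>"
  shows "(\<lambda>x. u x *\<^sub>R f x) \<in> Linf_space \<Omega>"
proof -
  obtain B where B: "0 \<le> B" "AE x in lebesgue_on \<Omega>. norm (u x) \<le> B"
    using assms(1) by (rule Linf_spaceE)
  obtain C where C: "0 \<le> C" "AE x in lebesgue_on \<Omega>. norm (f x) \<le> C"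
    using assms(2) by (rule Linf_spaceE)
  have "AE x in lebesgue_on \<Omega>. norm (u x *\<^sub>R f x) \<le> B * C"
    using B(2) C(2)
  proof eventually_elim
    case (elim x)
    then have "\<bar>u x\<bar> * norm (f x) \<le> B * C" using B(1) by (intro mult_mono) auto
    then show ?case by simp
  qed
  with borel_measurable_scaleR[OF assms[THEN Linf_space_measurable]] show ?thesis
    by (rule Linf_spaceI)
qed

text \<open>The integrals in the definition are those of products of essentially bounded functions on a set of
  finite measure, so they can be split.\<close>

lemma has_weak_gradient_diff:
  assumes \<Omega>: "open \<Omega>" "bounded \<Omega>"
    and u: "u \<in> Linf_space \<Omega>" "G \<in> Linf_space \<Omega>" "has_weak_gradient \<Omega> u G"
    and w: "w \<in> Linf_space \<Omega>" "H \<in> Linf_space \<Omega>" "has_weak_gradient \<Omega> w H"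
  shows "has_weak_gradient \<Omega> (\<lambda>x. u x - w x) (\<lambda>x. G x - H x)"
  unfolding has_weak_gradient_def
proof (intro ballI allI impI)
  fix \<phi> \<phi>' assume \<phi>: "\<phi> \<in> test_functions \<Omega>" and D: "\<forall>x. GDERIV \<phi> x :> \<phi>' x"
  have lm: "\<Omega> \<in> lmeasurable" using \<Omega> by (simp add: lmeasurable_open)
  obtain \<psi> where \<psi>: "\<And>x. GDERIV \<phi> x :> \<psi> x" "continuous_on UNIV \<phi>" "continuous_on UNIV \<psi>"
    using test_functionE[OF \<phi>] by blast
  have "\<phi>' = \<psi>" using D \<psi>(1) by (auto intro: GDERIV_unique)
  then have L: "\<phi> \<in> Linf_space \<Omega>" "\<phi>' \<in> Linf_space \<Omega>"
    using \<psi>(2,3) \<Omega>(2) lm by (auto intro!: continuous_in_Linf)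
  have int: "integrable (lebesgue_on \<Omega>) (\<lambda>x. p x *\<^sub>R q x)"
    if "p \<in> Linf_space \<Omega>" "q \<in> Linf_space \<Omega>" for p and q :: "real ^ 'a \<Rightarrow> real ^ 'a"
    using lm that by (intro Linf_integrable Linf_scaleR)
  have "(LINT x|lebesgue_on \<Omega>. u x *\<^sub>R \<phi>' x) = - (LINT x|lebesgue_on \<Omega>. \<phi> x *\<^sub>R G x)"
    "(LINT x|lebesgue_on \<Omega>. w x *\<^sub>R \<phi>' x) = - (LINT x|lebesgue_on \<Omega>. \<phi> x *\<^sub>R H x)"
    using u(3) w(3) \<phi> D by (auto simp: has_weak_gradient_def)
  then show "(LINT x|lebesgue_on \<Omega>. (u x - w x) *\<^sub>R \<phi>' x)
      = - (LINT x|lebesgue_on \<Omega>. \<phi> x *\<^sub>R (G x - H x))"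
    by (simp add: scaleR_diff_left scaleR_diff_right int u w L)
qed

lemma has_weak_gradient_unique:
  assumes \<Omega>: "open \<Omega>" "bounded \<Omega>"
    and G: "G \<in> Linf_space \<Omega>" "has_weak_gradient \<Omega> u G"
    and H: "H \<in> Linf_space \<Omega>" "has_weak_gradient \<Omega> u H"
  shows "AE x in lebesgue_on \<Omega>. G x = H x"
proof -
  have lm: "\<Omega> \<in> lmeasurable" using \<Omega> by (simp add: lmeasurable_open)
  have "AE x in lebesgue_on \<Omega>. G x - H x = 0"
  proof (rule AE_0_if_test_integrals_0[OF \<Omega>(1)])
    show "integrable (lebesgue_on \<Omega>) (\<lambda>x. G x - H x)"
      using G H lm by (intro Bochner_Integration.integrable_diff Linf_integrable)
    fix \<phi> assume \<phi>: "\<phi> \<in> test_functions \<Omega>"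
    then obtain \<phi>' where D: "\<And>x. GDERIV \<phi> x :> \<phi>' x" "continuous_on UNIV \<phi>"
      using test_functionE by blast
    then have L: "\<phi> \<in> Linf_space \<Omega>"
      using \<Omega>(2) lm by (auto intro!: continuous_in_Linf)
    have "- (LINT x|lebesgue_on \<Omega>. \<phi> x *\<^sub>R G x) = - (LINT x|lebesgue_on \<Omega>. \<phi> x *\<^sub>R H x)"
      using G(2)[unfolded has_weak_gradient_def, rule_format, OF \<phi>, of \<phi>']
        H(2)[unfolded has_weak_gradient_def, rule_format, OF \<phi>, of \<phi>'] D(1) by simp
    moreover have "integrable (lebesgue_on \<Omega>) (\<lambda>x. \<phi> x *\<^sub>R G x)"
      "integrable (lebesgue_on \<Omega>) (\<lambda>x. \<phi> x *\<^sub>R H x)"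
      using Linf_integrable[OF lm Linf_scaleR[OF L G(1)]] Linf_integrable[OF lm Linf_scaleR[OF L H(1)]]
      by auto
    ultimately show "(LINT x|lebesgue_on \<Omega>. \<phi> x *\<^sub>R (G x - H x)) = 0"
      by (simp add: scaleR_diff_right)
  qed
  then show ?thesis by simp
qed

lemma W1inf_in_Linf: "v \<in> W1inf \<Omega> \<Longrightarrow> v \<in> Linf_space \<Omega>"
  by (simp add: W1inf_def)

lemma
  assumes "v \<in> W1inf \<Omega>"
  shows weak_grad_in_Linf: "weak_grad \<Omega> v \<in> Linf_space \<Omega>"
    and weak_grad_is_weak_gradient: "has_weak_gradient \<Omega> v (weak_grad \<Omega> v)"
proof -
  have "\<exists>G. G \<in> Linf_space \<Omega> \<and> has_weak_gradient \<Omega> v G"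
    using assms by (auto simp: W1inf_def)
  from someI_ex[OF this] show "weak_grad \<Omega> v \<in> Linf_space \<Omega>" "has_weak_gradient \<Omega> v (weak_grad \<Omega> v)"
    unfolding weak_grad_def by auto
qed

lemma
  assumes \<Omega>: "open \<Omega>" "bounded \<Omega>" and u: "u \<in> W1inf \<Omega>" and w: "w \<in> W1inf \<Omega>"
  shows W1inf_diff: "(\<lambda>x. u x - w x) \<in> W1inf \<Omega>"
    and weak_grad_diff:
      "AE x in lebesgue_on \<Omega>. weak_grad \<Omega> (\<lambda>x. u x - w x) x = weak_grad \<Omega> u x - weak_grad \<Omega> w x"
proof -
  let ?G = "\<lambda>x. weak_grad \<Omega> u x - weak_grad \<Omega> w x"
  have G: "?G \<in> Linf_space \<Omega>" "has_weak_gradient \<Omega> (\<lambda>x. u x - w x) ?G"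
    using u w by (auto intro!: Linf_space_diff has_weak_gradient_diff[OF \<Omega>] W1inf_in_Linf
        weak_grad_in_Linf weak_grad_is_weak_gradient)
  then show W: "(\<lambda>x. u x - w x) \<in> W1inf \<Omega>"
    using u w by (auto simp: W1inf_def intro: Linf_space_diff)
  show "AE x in lebesgue_on \<Omega>. weak_grad \<Omega> (\<lambda>x. u x - w x) x = ?G x"
    by (rule has_weak_gradient_unique[OF \<Omega> weak_grad_in_Linf[OF W] weak_grad_is_weak_gradient[OF W] G])
qed

section \<open>Surface null sets\<close>

text \<open>All summands are nonnegative, so the supremum over meshes vanishes exactly if every infimum over
  covers does. In this form null sets can be combined cover by cover.\<close>

lemma hausdorff_outer_eq_0_iff:
  "hausdorff_outer s A = 0 \<longleftrightarrow>
     (\<forall>\<delta>>0. \<forall>e>0. \<exists>E :: nat \<Rightarrow> 'a::metric_space set.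
        A \<subseteq> (\<Union>i. E i) \<and> (\<forall>i. bounded (E i) \<and> diameter (E i) \<le> \<delta>) \<and>
        (\<Sum>i. if E i = {} then 0 else ennreal (unit_ball_vol (real s) * (diameter (E i) / 2) ^ s)) \<le> ennreal e)"
proof -
  let ?sum = "\<lambda>E :: nat \<Rightarrow> 'a set.
    \<Sum>i. if E i = {} then 0 else ennreal (unit_ball_vol (real s) * (diameter (E i) / 2) ^ s)"
  have "hausdorff_outer s A = 0 \<longleftrightarrow> (\<forall>\<delta>>0. (INF E\<in>{E. A \<subseteq> (\<Union>i. E i) \<and> (\<forall>i. bounded (E i) \<and> diameter (E i) \<le> \<delta>)}. ?sum E) = 0)"
    unfolding hausdorff_outer_def
    by (auto simp: bot_ennreal[symmetric] SUP_bot_conv)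
  also have "\<dots> \<longleftrightarrow> (\<forall>\<delta>>0. \<forall>e>0. \<exists>E. A \<subseteq> (\<Union>i. E i) \<and> (\<forall>i. bounded (E i) \<and> diameter (E i) \<le> \<delta>) \<and> ?sum E \<le> ennreal e)"
  proof (intro all_cong1 imp_cong refl)
    fix \<delta> :: real
    let ?C = "{E. A \<subseteq> (\<Union>i. E i) \<and> (\<forall>i. bounded (E i) \<and> diameter (E i) \<le> \<delta>)}"
    show "(INF E\<in>?C. ?sum E) = 0 \<longleftrightarrow> (\<forall>e>0. \<exists>E. A \<subseteq> (\<Union>i. E i) \<and> (\<forall>i. bounded (E i) \<and> diameter (E i) \<le> \<delta>) \<and> ?sum E \<le> ennreal e)"
    proof
      assume 0: "(INF E\<in>?C. ?sum E) = 0"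
      show "\<forall>e>0. \<exists>E. A \<subseteq> (\<Union>i. E i) \<and> (\<forall>i. bounded (E i) \<and> diameter (E i) \<le> \<delta>) \<and> ?sum E \<le> ennreal e"
      proof (intro allI impI)
        fix e :: real assume "e > 0"
        then have "(INF E\<in>?C. ?sum E) < ennreal e" unfolding 0 by simp
        then obtain E where "E \<in> ?C" "?sum E < ennreal e" unfolding INF_less_iff by blast
        then show "\<exists>E. A \<subseteq> (\<Union>i. E i) \<and> (\<forall>i. bounded (E i) \<and> diameter (E i) \<le> \<delta>) \<and> ?sum E \<le> ennreal e"
          by (intro exI[of _ E]) auto
      qed
    next
      assume *: "\<forall>e>0. \<exists>E. A \<subseteq> (\<Union>i. E i) \<and> (\<forall>i. bounded (E i) \<and> diameter (E i) \<le> \<delta>) \<and> ?sum E \<le> ennreal e"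
      have "(INF E\<in>?C. ?sum E) \<le> 0"
      proof (rule ennreal_le_epsilon)
        fix e :: real assume "0 < e"
        then obtain E where "E \<in> ?C" "?sum E \<le> ennreal e" using * by blast
        then show "(INF E\<in>?C. ?sum E) \<le> 0 + ennreal e"
          using INF_lower2[of E ?C ?sum] by simp
      qed
      then show "(INF E\<in>?C. ?sum E) = 0" by simp
    qed
  qed
  finally show ?thesis .
qed

lemma suminf_interleave_le:
  fixes a b :: "nat \<Rightarrow> ennreal"
  shows "(\<Sum>n. if even n then a (n div 2) else b (n div 2)) \<le> suminf a + suminf b"
proof (rule suminf_le_const[OF summableI])
  fix N
  let ?c = "\<lambda>n. if even n then a (n div 2) else b (n div 2)"
  have "(\<Sum>n<N. ?c n) \<le> (\<Sum>n<2 * N. ?c n)"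
    by (rule sum_mono2) auto
  also have "\<dots> = (\<Sum>n<N. a n) + (\<Sum>n<N. b n)"
    by (induction N) (auto simp: ac_simps)
  also have "\<dots> \<le> suminf a + suminf b"
    by (intro add_mono sum_le_suminf summableI) auto
  finally show "(\<Sum>n<N. ?c n) \<le> suminf a + suminf b" .
qed

lemma hausdorff_outer_0_subset: "hausdorff_outer s B = 0 \<Longrightarrow> A \<subseteq> B \<Longrightarrow> hausdorff_outer s A = 0"
  unfolding hausdorff_outer_eq_0_iff by (meson subset_trans)

text \<open>Covers of the two sets with total size at most \<open>e/2\<close> each are merged into one sequence by placing
  them at even and odd positions.\<close>

lemma hausdorff_outer_0_Un:
  assumes "hausdorff_outer s A = 0" "hausdorff_outer s B = 0"
  shows "hausdorff_outer s (A \<union> B) = 0"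
  unfolding hausdorff_outer_eq_0_iff
proof (intro allI impI)
  fix \<delta> e :: real assume \<delta>: "\<delta> > 0" and e: "e > 0"
  let ?w = "\<lambda>S :: 'a set. if S = {} then 0 else ennreal (unit_ball_vol (real s) * (diameter S / 2) ^ s)"
  from e have "e / 2 > 0" by simp
  with \<delta> obtain E where E: "A \<subseteq> (\<Union>i. E i)" "\<forall>i. bounded (E i) \<and> diameter (E i) \<le> \<delta>"
      "(\<Sum>i :: nat. ?w (E i)) \<le> ennreal (e / 2)"
    using assms(1) unfolding hausdorff_outer_eq_0_iff by meson
  from \<delta> \<open>e / 2 > 0\<close> obtain F where F: "B \<subseteq> (\<Union>i. F i)" "\<forall>i. bounded (F i) \<and> diameter (F i) \<le> \<delta>"
      "(\<Sum>i :: nat. ?w (F i)) \<le> ennreal (e / 2)"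
    using assms(2) unfolding hausdorff_outer_eq_0_iff by meson
  define H where "H n = (if even n then E (n div 2) else F (n div 2))" for n
  have "E i = H (2 * i)" "F i = H (2 * i + 1)" for i
    by (auto simp: H_def)
  then have "(\<Union>i. E i) \<subseteq> (\<Union>i. H i)" "(\<Union>i. F i) \<subseteq> (\<Union>i. H i)"
    by auto
  with E(1) F(1) have "A \<union> B \<subseteq> (\<Union>i. H i)" by (meson Un_least subset_trans)
  moreover have "\<forall>i. bounded (H i) \<and> diameter (H i) \<le> \<delta>"
    using E(2) F(2) by (auto simp: H_def)
  moreover have "(\<Sum>i. ?w (H i)) \<le> ennreal e"
  proof -
    have "(\<Sum>i. ?w (H i)) = (\<Sum>n. if even n then ?w (E (n div 2)) else ?w (F (n div 2)))"
      by (intro suminf_cong) (simp add: H_def)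
    also have "\<dots> \<le> (\<Sum>i. ?w (E i)) + (\<Sum>i. ?w (F i))"
      by (rule suminf_interleave_le)
    also have "\<dots> \<le> ennreal (e / 2) + ennreal (e / 2)"
      using E(3) F(3) by (rule add_mono)
    also have "\<dots> = ennreal e"
      using e by (subst ennreal_plus[symmetric]) auto
    finally show ?thesis .
  qed
  ultimately show "\<exists>E. A \<union> B \<subseteq> (\<Union>i. E i) \<and> (\<forall>i. bounded (E i) \<and> diameter (E i) \<le> \<delta>) \<and>
      (\<Sum>i :: nat. ?w (E i)) \<le> ennreal e"
    by blast
qed

lemma surface_AE_mp2:
  fixes \<Gamma> :: "(real ^ 'a) set"
  assumes "surface_AE \<Gamma> P" "surface_AE \<Gamma> Q" "\<And>x. x \<in> \<Gamma> \<Longrightarrow> P x \<Longrightarrow> Q x \<Longrightarrow> R x"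
  shows "surface_AE \<Gamma> R"
proof -
  let ?N = "{x \<in> \<Gamma>. \<not> P x} \<union> {x \<in> \<Gamma>. \<not> Q x}"
  have "hausdorff_outer (CARD('a) - 1) ?N = 0"
    using assms(1,2) unfolding surface_AE_def surface_measure_def by (rule hausdorff_outer_0_Un)
  moreover have "{x \<in> \<Gamma>. \<not> R x} \<subseteq> ?N" using assms(3) by auto
  ultimately show ?thesis
    unfolding surface_AE_def surface_measure_def by (rule hausdorff_outer_0_subset)
qed

lemma surface_AE_I: "(\<And>x. x \<in> \<Gamma> \<Longrightarrow> P x) \<Longrightarrow> surface_AE \<Gamma> P"
proof -
  assume "\<And>x. x \<in> \<Gamma> \<Longrightarrow> P x"
  then have "{x \<in> \<Gamma>. \<not> P x} = {}" by auto
  moreover have "hausdorff_outer s ({} :: (real ^ 'a) set) = 0" for s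
    unfolding hausdorff_outer_eq_0_iff by (auto intro!: exI[of _ "\<lambda>_. {}"])
  ultimately show ?thesis
    unfolding surface_AE_def surface_measure_def by (simp only:)
qed

section \<open>Traces and the load\<close>

text \<open>Two Lipschitz representatives differ on a relatively open null set of the open set \<open>\<Omega>\<close>, which must
  be empty; continuity carries the equality to the closure.\<close>

lemma has_trace_unique:
  assumes "open \<Omega>" "has_trace \<Omega> v V" "has_trace \<Omega> v W" "x \<in> closure \<Omega>"
  shows "V x = W x"
proof -
  let ?d = "\<lambda>x. V x - W x"
  have cont: "continuous_on (closure \<Omega>) ?d"
    using assms(2,3) unfolding has_trace_def
    by (intro continuous_on_diff) (blast intro: lipschitz_on_continuous_on)+
  have \<Omega>: "\<Omega> \<in> sets lebesgue" using \<open>open \<Omega>\<close> by (simp add: borel_open)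
  \<comment> \<open>The restriction to \<open>\<Omega>\<close> makes this set open, and a nonempty open set is not null.\<close>
  define S where "S = {x \<in> \<Omega>. ?d x \<noteq> 0}"
  have "open S"
  proof -
    have "continuous_on \<Omega> ?d" using cont closure_subset by (rule continuous_on_subset)
    then have "open (\<Omega> \<inter> ?d -` (- {0}))"
      using \<open>open \<Omega>\<close> by (intro continuous_open_preimage) auto
    then show ?thesis by (simp add: S_def vimage_def Int_def)
  qed
  have "AE x in lebesgue_on \<Omega>. v x = V x" "AE x in lebesgue_on \<Omega>. v x = W x"
    using assms(2,3) by (auto simp: has_trace_def)
  then have "AE x in lebesgue_on \<Omega>. x \<notin> S"
    by eventually_elim (simp add: S_def)
  then have "AE x in lebesgue. x \<in> \<Omega> \<longrightarrow> x \<notin> S"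
    using \<Omega> by (simp add: AE_restrict_space_iff)
  then have "AE x in lebesgue. x \<notin> S"
    by eventually_elim (auto simp: S_def)
  then have "S \<in> null_sets lebesgue"
    using \<open>open S\<close> AE_iff_null_sets[of S lebesgue] by (simp add: borel_open)
  then have "S = {}"
    using open_not_negligible[OF \<open>open S\<close>] negligible_iff_null_sets by blast
  then have "\<And>z. z \<in> \<Omega> \<Longrightarrow> ?d z = 0"
    unfolding S_def by blast
  then have "?d x = 0"
    using assms(4) by (rule continuous_constant_on_closure[OF cont])
  then show ?thesis by simp
qed

lemma has_trace_diff:
  assumes "has_trace \<Omega> u U" "has_trace \<Omega> w W"
  shows "has_trace \<Omega> (\<lambda>x. u x - w x) (\<lambda>x. U x - W x)"
proof -
  obtain L M where "L-lipschitz_on (closure \<Omega>) U" "M-lipschitz_on (closure \<Omega>) W"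
    using assms by (auto simp: has_trace_def)
  then have "(L + M)-lipschitz_on (closure \<Omega>) (\<lambda>x. U x - W x)"
    by (rule lipschitz_on_diff)
  moreover have "AE x in lebesgue_on \<Omega>. u x = U x" "AE x in lebesgue_on \<Omega>. w x = W x"
    using assms by (auto simp: has_trace_def)
  then have "AE x in lebesgue_on \<Omega>. u x - w x = U x - W x"
    by eventually_elim simp
  ultimately show ?thesis by (auto simp: has_trace_def)
qed

lemma has_trace_bdry_trace: "has_trace \<Omega> v V \<Longrightarrow> has_trace \<Omega> v (bdry_trace \<Omega> v)"
  unfolding bdry_trace_def by (rule someI[of "has_trace \<Omega> v"])

lemma trace_eq_on_diff:
  assumes "trace_eq_on \<Omega> \<Gamma> u z" "trace_eq_on \<Omega> \<Gamma> w z"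
  shows "trace_eq_on \<Omega> \<Gamma> (\<lambda>x. u x - w x) (\<lambda>x. 0)"
proof -
  obtain U where U: "has_trace \<Omega> u U" "surface_AE \<Gamma> (\<lambda>x. U x = z x)"
    using assms(1) by (auto simp: trace_eq_on_def)
  obtain W where W: "has_trace \<Omega> w W" "surface_AE \<Gamma> (\<lambda>x. W x = z x)"
    using assms(2) by (auto simp: trace_eq_on_def)
  have "surface_AE \<Gamma> (\<lambda>x. U x - W x = 0)"
    using U(2) W(2) by (rule surface_AE_mp2) simp
  then show ?thesis
    unfolding trace_eq_on_def using has_trace_diff[OF U(1) W(1)] by blast
qed

lemma trace_in_surf_W1inf:
  assumes "bounded \<Omega>" "\<Gamma> \<subseteq> closure \<Omega>" "has_trace \<Omega> v V"
  shows "V \<in> surf_W1inf \<Gamma>"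
proof -
  obtain L where L: "L-lipschitz_on (closure \<Omega>) V" using assms(3) by (auto simp: has_trace_def)
  then have "compact (V ` closure \<Omega>)"
    using assms(1) by (intro compact_continuous_image lipschitz_on_continuous_on[of L]) auto
  then obtain B where "\<forall>x\<in>closure \<Omega>. \<bar>V x\<bar> \<le> B"
    using compact_imp_bounded by (force simp: bounded_iff)
  moreover have "0 \<le> L" using L by (rule lipschitz_on_nonneg)
  ultimately have "surf_W1inf_bound \<Gamma> V (max 0 B) L"
    unfolding surf_W1inf_bound_def using assms(2) L
    by (auto intro!: exI[of _ V] exI[of _ 1] surface_AE_I
        intro: lipschitz_on_subset max.coboundedI2)
  then show ?thesis by (auto simp: surf_W1inf_def)
qed

lemma surf_W1inf_uminus:
  assumes "w \<in> surf_W1inf \<Gamma>"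
  shows "(\<lambda>x. - 1 * w x) \<in> surf_W1inf \<Gamma>"
proof -
  obtain B L w' where w': "0 \<le> B" "0 \<le> L" "surface_AE \<Gamma> (\<lambda>x. w x = w' x)" "\<forall>x\<in>\<Gamma>. \<bar>w' x\<bar> \<le> B"
      "\<forall>x\<in>\<Gamma>. \<exists>\<epsilon>>0. L-lipschitz_on (\<Gamma> \<inter> ball x \<epsilon>) w'"
    using assms unfolding surf_W1inf_def surf_W1inf_bound_def by blast
  have "surface_AE \<Gamma> (\<lambda>x. - 1 * w x = - w' x)"
    using w'(3,3) by (rule surface_AE_mp2) simp
  then have "surf_W1inf_bound \<Gamma> (\<lambda>x. - 1 * w x) B L"
    unfolding surf_W1inf_bound_def using w'(1,2,4,5) by (intro conjI exI[of _ "\<lambda>x. - w' x"]) auto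
  then show ?thesis by (auto simp: surf_W1inf_def)
qed

lemma surf_W1inf_dual_diff:
  assumes g: "g \<in> surf_W1inf_dual \<Gamma>" and u: "u \<in> surf_W1inf \<Gamma>" and w: "w \<in> surf_W1inf \<Gamma>"
  shows "g (\<lambda>x. u x - w x) = g u - g w"
proof -
  have add: "\<forall>u\<in>surf_W1inf \<Gamma>. \<forall>w\<in>surf_W1inf \<Gamma>. g (\<lambda>x. u x + w x) = g u + g w"
    and scale: "\<forall>c. \<forall>w\<in>surf_W1inf \<Gamma>. g (\<lambda>x. c * w x) = c * g w"
    using g by (auto simp: surf_W1inf_dual_def)
  have "g (\<lambda>x. u x + - 1 * w x) = g u + g (\<lambda>x. - 1 * w x)"
    by (rule add[rule_format, OF u surf_W1inf_uminus[OF w]])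
  moreover have "g (\<lambda>x. - 1 * w x) = - 1 * g w"
    by (rule scale[rule_format, OF w])
  ultimately show ?thesis by simp
qed

text \<open>A function vanishing on \<open>\<Gamma>\<close> has norm zero, so a bounded functional maps it to zero. This makes the
  load independent of the values that a chosen trace takes away from the boundary.\<close>

lemma surf_W1inf_dual_cong:
  assumes g: "g \<in> surf_W1inf_dual \<Gamma>" and u: "u \<in> surf_W1inf \<Gamma>" and w: "w \<in> surf_W1inf \<Gamma>"
    and eq: "\<And>x. x \<in> \<Gamma> \<Longrightarrow> u x = w x"
  shows "g u = g w"
proof -
  let ?z = "\<lambda>x. u x - w x"
  have bound: "surf_W1inf_bound \<Gamma> ?z 0 0"
    unfolding surf_W1inf_bound_def using eq
    by (auto intro!: exI[of _ "\<lambda>x. 0"] exI[of _ 1] surface_AE_I lipschitz_on_constant)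
  then have z: "?z \<in> surf_W1inf \<Gamma>" by (auto simp: surf_W1inf_def)
  have "surf_W1inf_norm \<Gamma> ?z = 0"
    unfolding surf_W1inf_norm_def
  proof (rule cInf_eq_minimum)
    show "0 \<in> {B + L | B L. surf_W1inf_bound \<Gamma> ?z B L}" using bound by force
    show "0 \<le> t" if "t \<in> {B + L | B L. surf_W1inf_bound \<Gamma> ?z B L}" for t
      using that by (auto simp: surf_W1inf_bound_def)
  qed
  moreover obtain C where "\<forall>w\<in>surf_W1inf \<Gamma>. \<bar>g w\<bar> \<le> C * surf_W1inf_norm \<Gamma> w"
    using g unfolding surf_W1inf_dual_def by blast
  ultimately have "\<bar>g ?z\<bar> \<le> C * 0" using z by metis
  then show ?thesis
    using surf_W1inf_dual_diff[OF g u w] by simp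
qed

text \<open>The chosen trace of a difference need not be the difference of the chosen traces, but the two agree
  on the closure of \<open>\<Omega>\<close> and thus have the same image under \<open>g\<close>.\<close>

lemma load_diff:
  assumes \<Omega>: "open \<Omega>" "bounded \<Omega>" and \<Gamma>: "\<Gamma> \<subseteq> closure \<Omega>"
    and f: "f \<in> L1_space \<Omega>" and g: "g \<in> surf_W1inf_dual \<Gamma>"
    and u: "u \<in> Linf_space \<Omega>" "has_trace \<Omega> u U"
    and w: "w \<in> Linf_space \<Omega>" "has_trace \<Omega> w W"
  shows "load \<Omega> f g (\<lambda>x. u x - w x) = load \<Omega> f g u - load \<Omega> f g w"
proof -
  have int: "integrable (lebesgue_on \<Omega>) (\<lambda>x. f x * p x)" if p: "p \<in> Linf_space \<Omega>" for p
  proof -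
    obtain C where "AE x in lebesgue_on \<Omega>. norm (p x) \<le> C" using p by (rule Linf_spaceE)
    then have "integrable (lebesgue_on \<Omega>) (\<lambda>x. p x \<bullet> f x)"
      using f by (intro integrable_bounded_inner Linf_space_measurable[OF p]) (auto simp: L1_space_def)
    then show ?thesis by (simp add: mult.commute)
  qed
  let ?T = "bdry_trace \<Omega> (\<lambda>x. u x - w x)" and ?U = "bdry_trace \<Omega> u" and ?W = "bdry_trace \<Omega> w"
  have U: "has_trace \<Omega> u ?U" and W: "has_trace \<Omega> w ?W"
    using u(2) w(2) by (auto intro: has_trace_bdry_trace)
  have D: "has_trace \<Omega> (\<lambda>x. u x - w x) (\<lambda>x. ?U x - ?W x)"
    using U W by (rule has_trace_diff)
  then have T: "has_trace \<Omega> (\<lambda>x. u x - w x) ?T"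
    by (rule has_trace_bdry_trace)
  note surf = trace_in_surf_W1inf[OF \<Omega>(2) \<Gamma>]
  have "g ?T = g (\<lambda>x. ?U x - ?W x)"
    using g surf[OF T] surf[OF D]
  proof (rule surf_W1inf_dual_cong)
    show "?T x = ?U x - ?W x" if "x \<in> \<Gamma>" for x
      using has_trace_unique[OF \<Omega>(1) T D] \<Gamma> that by blast
  qed
  also have "\<dots> = g ?U - g ?W"
    using g surf[OF U] surf[OF W] by (rule surf_W1inf_dual_diff)
  finally show ?thesis
    using int[OF u(1)] int[OF w(1)] by (simp add: load_def right_diff_distrib)
qed

section \<open>Energies and the gap identity\<close>

lemma ereal_integral_eq_integral:
  assumes k: "integrable M k" and h: "AE x in M. h x = ereal (k x)"
  shows "ereal_integral M h = ereal (LINT x|M. k x)"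
proof -
  obtain p q where pq: "0 \<le> p" "(\<integral>\<^sup>+x. ennreal (k x) \<partial>M) = ennreal p"
      "0 \<le> q" "(\<integral>\<^sup>+x. ennreal (- k x) \<partial>M) = ennreal q"
    using k by (metis ennreal_cases real_integrable_def infinity_ennreal_def)
  have "(\<integral>\<^sup>+x. e2ennreal (h x) \<partial>M) = (\<integral>\<^sup>+x. ennreal (k x) \<partial>M)"
    using h by (intro nn_integral_cong_AE) (auto elim: eventually_mono)
  moreover have "(\<integral>\<^sup>+x. e2ennreal (- h x) \<partial>M) = (\<integral>\<^sup>+x. ennreal (- k x) \<partial>M)"
    using h by (intro nn_integral_cong_AE) (auto elim: eventually_mono)
  ultimately show ?thesis
    using pq by (simp add: ereal_integral_def real_lebesgue_integral_def[OF k])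
qed

text \<open>The function \<open>phi_star\<close> grows at most linearly in its last argument, with constants controlled by an essential
  bound of \<open>\<zeta>\<close>.\<close>

lemma phi_star_integrable:
  assumes lm: "\<Omega> \<in> lmeasurable" and \<zeta>: "\<zeta> \<in> Linf_space \<Omega>" and y: "integrable (lebesgue_on \<Omega>) y"
  shows "integrable (lebesgue_on \<Omega>) (\<lambda>x. phi_star \<zeta> x (y x))"
proof -
  obtain C where C: "0 \<le> C" "AE x in lebesgue_on \<Omega>. norm (\<zeta> x) \<le> C"
    using \<zeta> by (rule Linf_spaceE)
  have bound: "\<bar>phi_star \<zeta> x s\<bar> \<le> C * norm s + C\<^sup>2" if "\<bar>\<zeta> x\<bar> \<le> C" for x s
  proof (cases "norm s \<le> \<zeta> x")
    case True
    then have "norm s * norm s \<le> C * norm s" using that by (intro mult_right_mono) auto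
    moreover have "phi_star \<zeta> x s = norm s * norm s / 2"
      using True by (simp add: phi_star_def power2_eq_square)
    moreover have "0 \<le> norm s * norm s" "0 \<le> C\<^sup>2" by simp_all
    ultimately show ?thesis by linarith
  next
    case False
    have "\<bar>\<zeta> x * norm s\<bar> \<le> C * norm s" using that by (simp add: abs_mult mult_right_mono)
    moreover have "(\<zeta> x)\<^sup>2 \<le> C\<^sup>2" using that C(1) by (simp add: abs_le_square_iff[symmetric])
    moreover have "phi_star \<zeta> x s = \<zeta> x * norm s - (\<zeta> x)\<^sup>2 / 2"
      using False by (simp add: phi_star_def)
    moreover have "0 \<le> (\<zeta> x)\<^sup>2" by simp
    ultimately show ?thesis by linarith
  qed
  show ?thesis
  proof (rule Bochner_Integration.integrable_bound)
    interpret finite_measure "lebesgue_on \<Omega>" using lm by (rule finite_measure_lebesgue_on)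
    show "integrable (lebesgue_on \<Omega>) (\<lambda>x. C * norm (y x) + C\<^sup>2)"
      using integrable_norm[OF y] by simp
    have [measurable]: "\<zeta> \<in> borel_measurable (lebesgue_on \<Omega>)" "y \<in> borel_measurable (lebesgue_on \<Omega>)"
      using Linf_space_measurable[OF \<zeta>] borel_measurable_integrable[OF y] by auto
    show "(\<lambda>x. phi_star \<zeta> x (y x)) \<in> borel_measurable (lebesgue_on \<Omega>)"
      unfolding phi_star_def by measurable
    show "AE x in lebesgue_on \<Omega>. norm (phi_star \<zeta> x (y x)) \<le> norm (C * norm (y x) + C\<^sup>2)"
      using C(2)
    proof eventually_elim
      case (elim x)
      then show ?case using bound[of x "y x"] C(1) by simp
    qed
  qed
qed

text \<open>Under the gradient constraint the extended real integrand is finite almost everywhere and equals a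
  sum of three separately integrable functions, so its integral is a real number and splits.\<close>

lemma gap_estimator_A_eq:
  assumes lm: "\<Omega> \<in> lmeasurable" and \<zeta>: "\<zeta> \<in> Linf_space \<Omega>" and y: "integrable (lebesgue_on \<Omega>) y"
    and z: "weak_grad \<Omega> v \<in> Linf_space \<Omega>"
    and le: "AE x in lebesgue_on \<Omega>. norm (weak_grad \<Omega> v x) \<le> \<zeta> x"
  shows "gap_estimator_A \<Omega> \<zeta> v y = ereal ((LINT x|lebesgue_on \<Omega>. (norm (weak_grad \<Omega> v x))\<^sup>2) / 2
           - (LINT x|lebesgue_on \<Omega>. weak_grad \<Omega> v x \<bullet> y x)
           + (LINT x|lebesgue_on \<Omega>. phi_star \<zeta> x (y x)))"
proof -
  let ?z = "weak_grad \<Omega> v"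
  let ?k = "\<lambda>x. (norm (?z x))\<^sup>2 / 2 - ?z x \<bullet> y x + phi_star \<zeta> x (y x)"
  obtain C where C: "AE x in lebesgue_on \<Omega>. norm (?z x) \<le> C" using z by (rule Linf_spaceE)
  have i1: "integrable (lebesgue_on \<Omega>) (\<lambda>x. (norm (?z x))\<^sup>2)"
    using integrable_bounded_inner[OF Linf_integrable[OF lm z] Linf_space_measurable[OF z] C]
    by (simp add: dot_square_norm)
  have i2: "integrable (lebesgue_on \<Omega>) (\<lambda>x. ?z x \<bullet> y x)"
    using y Linf_space_measurable[OF z] C by (rule integrable_bounded_inner)
  have i3: "integrable (lebesgue_on \<Omega>) (\<lambda>x. phi_star \<zeta> x (y x))"
    using lm \<zeta> y by (rule phi_star_integrable)
  have "gap_estimator_A \<Omega> \<zeta> v y = ereal (LINT x|lebesgue_on \<Omega>. ?k x)"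
    unfolding gap_estimator_A_def
  proof (rule ereal_integral_eq_integral)
    show "integrable (lebesgue_on \<Omega>) ?k" using i1 i2 i3 by simp
    show "AE x in lebesgue_on \<Omega>. phi \<zeta> x (?z x) - ereal (?z x \<bullet> y x) + ereal (phi_star \<zeta> x (y x)) = ereal (?k x)"
      using le by eventually_elim (simp add: phi_def)
  qed
  then show ?thesis using i1 i2 i3 by simp
qed

lemma lebesgue_decomposition_parts:
  assumes "lebesgue_decomposition \<Omega> \<nu> y \<nu>s"
  obtains \<nu>s' y' where "lebesgue_decomposition \<Omega> \<nu> (regular_part \<Omega> \<nu>) \<nu>s'"
    "lebesgue_decomposition \<Omega> \<nu> y' (singular_part \<Omega> \<nu>)"
proof -
  have "\<exists>\<nu>s. lebesgue_decomposition \<Omega> \<nu> (regular_part \<Omega> \<nu>) \<nu>s"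
    unfolding regular_part_def
    using someI_ex[of "\<lambda>y. \<exists>\<nu>s. lebesgue_decomposition \<Omega> \<nu> y \<nu>s"] assms by blast
  moreover have "\<exists>y. lebesgue_decomposition \<Omega> \<nu> y (singular_part \<Omega> \<nu>)"
    unfolding singular_part_def
    using someI_ex[of "\<lambda>\<nu>s. \<exists>y. lebesgue_decomposition \<Omega> \<nu> y \<nu>s"] assms by blast
  ultimately show ?thesis using that by blast
qed

theorem lemma4p1:
  fixes \<Omega> \<Gamma>\<^sub>D \<Gamma>\<^sub>N :: "(real ^ 'd) set"
    and f \<zeta> u\<^sub>D uhat v :: "real ^ 'd \<Rightarrow> real"
    and g :: "(real ^ 'd \<Rightarrow> real) \<Rightarrow> real"
    and y :: "real ^ 'd \<Rightarrow> real ^ 'd"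
    and \<nu> \<nu>s :: "(real ^ 'd) set \<Rightarrow> real ^ 'd"
  assumes "bounded \<Omega>" and "lipschitz_domain \<Omega>" and "simplicial_domain \<Omega>"
    and "boundary_partition \<Omega> \<Gamma>\<^sub>D \<Gamma>\<^sub>N" and "surface_measure \<Gamma>\<^sub>D > 0"
    and "f \<in> L1_space \<Omega>"
    and "g \<in> surf_W1inf_dual \<Gamma>\<^sub>N"
    and "\<zeta> \<in> Linf_space \<Omega>" and "essinf (lebesgue_on \<Omega>) (\<lambda>x. ereal (\<zeta> x)) > 0"
    and "u\<^sub>D \<in> surf_W1inf \<Gamma>\<^sub>D"
    and "uhat \<in> W1inf \<Omega>" and "trace_eq_on \<Omega> \<Gamma>\<^sub>D uhat u\<^sub>D"
    and "Linf_norm \<Omega> (\<lambda>x. weak_grad \<Omega> uhat x /\<^sub>R \<zeta> x) < 1"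
    and "v \<in> primal_admissible \<Omega> \<Gamma>\<^sub>D \<zeta> u\<^sub>D"
    and "\<nu> \<in> dual_admissible \<Omega> \<Gamma>\<^sub>D f g"
    and "lebesgue_decomposition \<Omega> \<nu> y \<nu>s"
  shows "gap_estimator \<Omega> \<Gamma>\<^sub>D \<zeta> u\<^sub>D uhat f g v \<nu> =
           gap_estimator_A \<Omega> \<zeta> v y + ereal (gap_estimator_B \<Omega> \<zeta> v \<nu>s)"
proof -
  let ?M = "lebesgue_on \<Omega>"
  have op: "open \<Omega>" and ne: "\<Omega> \<noteq> {}" using \<open>lipschitz_domain \<Omega>\<close> by (auto simp: lipschitz_domain_def)
  have lm: "\<Omega> \<in> lmeasurable" using op \<open>bounded \<Omega>\<close> by (simp add: lmeasurable_open)
  have nonnull: "emeasure ?M \<Omega> \<noteq> 0"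
    using open_not_negligible[OF op ne] lm
    by (auto simp: negligible_iff_null_sets null_sets_def emeasure_restrict_space fmeasurable_def)
  have \<Gamma>N: "\<Gamma>\<^sub>N \<subseteq> closure \<Omega>"
    using \<open>boundary_partition \<Omega> \<Gamma>\<^sub>D \<Gamma>\<^sub>N\<close> openin_imp_subset
    by (fastforce simp: boundary_partition_def frontier_def)
  have v: "v \<in> W1inf \<Omega>" and v_le: "AE x in ?M. norm (weak_grad \<Omega> v x) \<le> \<zeta> x"
    and v_tr: "trace_eq_on \<Omega> \<Gamma>\<^sub>D v u\<^sub>D"
    using \<open>v \<in> primal_admissible _ _ _ _\<close> by (auto simp: primal_admissible_def)
  have \<nu>: "\<nu> \<in> ba \<Omega>" and \<nu>_bal: "\<And>w. w \<in> W1inf_D \<Omega> \<Gamma>\<^sub>D \<Longrightarrow> ba_pairing \<Omega> \<nu> (weak_grad \<Omega> w) = load \<Omega> f g w"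
    using \<open>\<nu> \<in> dual_admissible _ _ _ _\<close> by (auto simp: dual_admissible_def)
  note dec = \<open>lebesgue_decomposition \<Omega> \<nu> y \<nu>s\<close>
  have y: "integrable ?M y" using dec by (simp add: lebesgue_decomposition_def L1_space_def)
  \<comment> \<open>The test function that eliminates the load and \<open>uhat\<close> from the gap.\<close>
  let ?w = "\<lambda>x. v x - uhat x"
  have w: "?w \<in> W1inf \<Omega>" using op \<open>bounded \<Omega>\<close> v \<open>uhat \<in> W1inf \<Omega>\<close> by (rule W1inf_diff)
  then have "?w \<in> W1inf_D \<Omega> \<Gamma>\<^sub>D"
    using trace_eq_on_diff[OF v_tr \<open>trace_eq_on \<Omega> \<Gamma>\<^sub>D uhat u\<^sub>D\<close>] by (simp add: W1inf_D_def)
  then have "load \<Omega> f g ?w = ba_pairing \<Omega> \<nu> (weak_grad \<Omega> ?w)" by (simp add: \<nu>_bal)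
  also have "\<dots> = ba_pairing \<Omega> \<nu> (\<lambda>x. weak_grad \<Omega> v x - weak_grad \<Omega> uhat x)"
    using v w \<open>uhat \<in> W1inf \<Omega>\<close> weak_grad_diff[OF op \<open>bounded \<Omega>\<close> v \<open>uhat \<in> W1inf \<Omega>\<close>]
    by (intro ba_pairing_AE_cong[OF nonnull \<nu>] weak_grad_in_Linf Linf_space_diff)
  also have "\<dots> = ba_pairing \<Omega> \<nu> (weak_grad \<Omega> v) - ba_pairing \<Omega> \<nu> (weak_grad \<Omega> uhat)"
    using v \<open>uhat \<in> W1inf \<Omega>\<close> by (intro ba_pairing_diff[OF nonnull \<nu>] weak_grad_in_Linf)
  finally have "load \<Omega> f g ?w = ba_pairing \<Omega> \<nu> (weak_grad \<Omega> v) - ba_pairing \<Omega> \<nu> (weak_grad \<Omega> uhat)" .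
  moreover have "load \<Omega> f g ?w = load \<Omega> f g v - load \<Omega> f g uhat"
  proof -
    obtain V U where "has_trace \<Omega> v V" "has_trace \<Omega> uhat U"
      using v_tr \<open>trace_eq_on \<Omega> \<Gamma>\<^sub>D uhat u\<^sub>D\<close> by (auto simp: trace_eq_on_def)
    then show ?thesis
      using load_diff[OF op \<open>bounded \<Omega>\<close> \<Gamma>N \<open>f \<in> L1_space \<Omega>\<close> \<open>g \<in> surf_W1inf_dual \<Gamma>\<^sub>N\<close>
          W1inf_in_Linf[OF v] _ W1inf_in_Linf[OF \<open>uhat \<in> W1inf \<Omega>\<close>]] by blast
  qed
  moreover have "ba_pairing \<Omega> \<nu> (weak_grad \<Omega> v)
      = (LINT x|?M. weak_grad \<Omega> v x \<bullet> y x) + ba_pairing \<Omega> \<nu>s (weak_grad \<Omega> v)"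
    using nonnull \<nu> dec weak_grad_in_Linf[OF v] by (rule ba_pairing_lebesgue_decomposition)
  \<comment> \<open>The dual functional uses chosen parts of \<open>\<nu>\<close>; they are exchanged for \<open>y\<close> and \<open>\<nu>s\<close>.\<close>
  moreover obtain \<nu>s' y' where parts: "lebesgue_decomposition \<Omega> \<nu> (regular_part \<Omega> \<nu>) \<nu>s'"
      "lebesgue_decomposition \<Omega> \<nu> y' (singular_part \<Omega> \<nu>)"
    using dec by (rule lebesgue_decomposition_parts)
  have "(LINT x|?M. phi_star \<zeta> x (regular_part \<Omega> \<nu> x)) = (LINT x|?M. phi_star \<zeta> x (y x))"
  proof (rule integral_cong_AE)
    have "integrable ?M (regular_part \<Omega> \<nu>)"
      using parts(1) by (simp add: lebesgue_decomposition_def L1_space_def)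
    then show "(\<lambda>x. phi_star \<zeta> x (regular_part \<Omega> \<nu> x)) \<in> borel_measurable ?M"
      "(\<lambda>x. phi_star \<zeta> x (y x)) \<in> borel_measurable ?M"
      using y phi_star_integrable[OF lm \<open>\<zeta> \<in> Linf_space \<Omega>\<close>] borel_measurable_integrable by blast+
    show "AE x in ?M. phi_star \<zeta> x (regular_part \<Omega> \<nu> x) = phi_star \<zeta> x (y x)"
      using lebesgue_decomposition_unique(1)[OF lm parts(1) dec] by eventually_elim simp
  qed
  moreover have "scale_ba \<Omega> \<zeta> (singular_part \<Omega> \<nu>) = scale_ba \<Omega> \<zeta> \<nu>s"
    by (rule scale_ba_cong) (rule lebesgue_decomposition_unique(2)[OF lm parts(2) dec])
  ultimately show ?thesis
    using \<open>v \<in> primal_admissible _ _ _ _\<close> \<open>\<nu> \<in> dual_admissible _ _ _ _\<close>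
    by (simp add: gap_estimator_def primal_functional_def dual_functional_def gap_estimator_B_def
        gap_estimator_A_eq[OF lm \<open>\<zeta> \<in> Linf_space \<Omega>\<close> y weak_grad_in_Linf[OF v] v_le])
qed

end
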